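(* Let $X,Y$ be coverable uniform spaces, $f:X\to Y$ uniformly continuous and basepoint-preserving, and let $\phi:\widetilde{X}\to X$ and $\psi:\widetilde{Y}\to Y$ be the projections. Then there is a unique uniformly continuous function $\widetilde{f}:\widetilde{X}\to\widetilde{Y}$ such that $\widetilde{f}( * )=*$ and $f\circ\phi=\psi\circ\widetilde{f}$. Moreover: (1) For any $x\in\widetilde{X}$ and $g\in\delta_1(X)$, $\widetilde{f}(g(x))=\widetilde{f}(g)(\widetilde{f}(x))$. (2) The restriction $f_*$ of $\widetilde{f}$ to $\delta_1(X)$ is a homomorphism into $\delta_1(Y)$. (3) If $f$ is a discrete cover then $\widetilde{f}$ is a uniform homeomorphism. (4) If $Z$ is a uniform space and $g:Y\to Z$ is uniformly continuous and basepoint-preserving, then $\widetilde{g\circ f}=\widetilde{g}\circ\widetilde{f}$ (and in particular $(g\circ f)_*=g_*\circ f_*$).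
   Context: All entourages are taken to be symmetric. Each space has a fixed basepoint $*$. For an entourage $E$ of a uniform space $X$, an $E$-chain from $p$ to $q$ is a finite sequence $\{x_0=p,\dots,x_n=q\}$ with $(x_i,x_{i+1})\in E$ for all $i$; it is an $E$-loop if $p=q$. Two $E$-chains with the same endpoints are $E$-homotopic if one is obtained from the other in finitely many steps, each adding or removing a single point, always keeping the endpoints fixed and keeping an $E$-chain at each stage (in particular $\{p\}$ and $\{p,p\}$ are $E$-homotopic); $[\alpha]_E$ is the class of $\alpha$. $X_E$ is the set of $E$-homotopy classes of $E$-chains starting at $*$, with basepoint $[*]_E$. For an entourage $D\subset E$ let $D^*$ be the set of pairs $([*=x_0,\dots,x_n,y]_E,[*=x_0,\dots,x_n,z]_E)$ with $(y,z)\in D$; $X_E$ carries the uniformity with base $\{D^*:D\subset E\}$. The endpoint map is $\phi_{XE}:X_E\to X$, and for $F\subset E$, $\phi_{EF}:X_F\to X_E$ is $[\alpha]_F\mapsto[\alpha]_E$. $\widetilde{X}=\varprojlim X_E$ (over all entourages, ordered by reverse inclusion, with the inverse limit uniformity and basepoint $*=([*]_E)_E$), with projections $\phi_E:\widetilde{X}\to X_E$ and $\phi:\widetilde{X}\to X=X_{X\times X}$. $X$ is coverable if its uniformity has a base, containing $X\times X$, of entourages $E$ for which $\phi_E$ is surjective. $\delta_E(X)$ is the group of $E$-homotopy classes of $E$-loops at $*$ under concatenation, acting on $X_E$ by $[\lambda]_E\cdot[\alpha]_E=[\lambda*\alpha]_E$ (concatenation of $\alpha$ after $\lambda$). $\delta_1(X)=\varprojlim\delta_E(X)$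 (bonding maps $[\lambda]_F\mapsto[\lambda]_E$) acts coordinatewise on $\widetilde{X}$; as a subset of $\widetilde{X}$ it equals $\phi^{-1}( * )$, so that $\widetilde f(g)$ makes sense for $g\in\delta_1(X)$ and lies in $\psi^{-1}( * )=\delta_1(Y)$. Discrete cover: a map which, up to uniform homeomorphism of the target, is the quotient map $X\to X/G$ (quotient uniformity, with base the images of entourages) for a group $G$ of uniform homeomorphisms of $X$ such that the uniformity has a base of entourages $E$ with $(g\times g)(E)=E$ for all $g\in G$, and such that for some entourage $E$, $(g(x),x)\in E$ for some $x$ implies $g=1$. For $Z$ an arbitrary pointed uniform space, $\widetilde{g}:\widetilde{Y}\to\widetilde{Z}$ denotes the unique uniformly continuous basepoint-preserving map whose composition with the projection $\widetilde{Z}\to Z$ is $g\circ\psi$, and similarly $\widetilde{g\circ f}:\widetilde{X}\to\widetilde{Z}$ (such lifts exist and are unique because $\widetilde{X}$ and $\widetilde{Y}$ are universal, i.e. have a base of entourages $E$ for which the endpoint map $\phi_{\widetilde X E}$, resp. $\phi_{\widetilde Y E}$, is a uniform homeomorphism); $g_*$ and $(g\circ f)_*$ are their restrictions to $\delta_1(Y)$ and $\delta_1(X)$. *)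

theory Defs
  imports Complex_Main "HOL-Algebra.Product_Groups" "HOL-Algebra.Bij"
begin

section \<open>Pointed uniform spaces\<close>

text \<open>The class \<^class>\<open>uniform_space\<close> cannot be used for the spaces constructed below, whose
  points depend on an entourage of another space.  Hence a uniform space is given by a set of
  points and a filter on pairs that lives on this set; the axioms are those of the class,
  relativised to the set of points.  No separation axiom is imposed.\<close>

record 'a uspace =
  points :: "'a set"
  unif :: "('a \<times> 'a) filter"
  base :: 'a

definition pointed_uniform_space :: "'a uspace \<Rightarrow> bool" where
  "pointed_uniform_space X \<longleftrightarrow>
     base X \<in> points X \<and>
     unif X \<le> principal (points X \<times> points X) \<and>
     (\<forall>P. eventually P (unif X) \<longrightarrow>
        (\<forall>x\<in>points X. P (x, x)) \<and>
        eventually (\<lambda>(x, y). P (y, x)) (unif X) \<and>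
        (\<exists>Q. eventually Q (unif X) \<and> (\<forall>x y z. Q (x, y) \<longrightarrow> Q (y, z) \<longrightarrow> P (x, z))))"

lemma pointed_uniform_space_class:
  "pointed_uniform_space
     \<lparr>points = UNIV, unif = uniformity, base = (p :: 'a :: uniform_space)\<rparr>"
  unfolding pointed_uniform_space_def
  using uniformity_refl uniformity_sym uniformity_trans by fastforce

text \<open>Entourages are symmetric throughout.\<close>

definition entourages :: "'a uspace \<Rightarrow> ('a \<times> 'a) set set" where
  "entourages X =
     {E. E \<subseteq> points X \<times> points X \<and> sym E \<and> eventually (\<lambda>p. p \<in> E) (unif X)}"

definition ucontinuous :: "'a uspace \<Rightarrow> 'b uspace \<Rightarrow> ('a \<Rightarrow> 'b) \<Rightarrow> bool" where
  "ucontinuous X Y f \<longleftrightarrow>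
     f \<in> points X \<rightarrow> points Y \<and> filterlim (map_prod f f) (unif Y) (unif X)"

definition uhomeomorphism :: "'a uspace \<Rightarrow> 'b uspace \<Rightarrow> ('a \<Rightarrow> 'b) \<Rightarrow> bool" where
  "uhomeomorphism X Y f \<longleftrightarrow>
     bij_betw f (points X) (points Y) \<and>
     ucontinuous X Y f \<and> ucontinuous Y X (inv_into (points X) f)"


section \<open>Chains and the spaces of homotopy classes of chains\<close>

definition echain :: "'a uspace \<Rightarrow> ('a \<times> 'a) set \<Rightarrow> 'a list \<Rightarrow> bool" where
  "echain X E c \<longleftrightarrow>
     c \<noteq> [] \<and> set c \<subseteq> points X \<and> successively (\<lambda>x y. (x, y) \<in> E) c"

definition insertion :: "'a uspace \<Rightarrow> ('a \<times> 'a) set \<Rightarrow> ('a list \<times> 'a list) set" where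
  "insertion X E =
     {(c, d). echain X E c \<and> echain X E d \<and> hd c = hd d \<and> last c = last d \<and>
        (\<exists>us x vs. c = us @ vs \<and> d = us @ x # vs)}"

definition ehomotopy :: "'a uspace \<Rightarrow> ('a \<times> 'a) set \<Rightarrow> ('a list \<times> 'a list) set" where
  "ehomotopy X E = (insertion X E \<union> (insertion X E)\<inverse>)\<^sup>*"

definition eclass :: "'a uspace \<Rightarrow> ('a \<times> 'a) set \<Rightarrow> 'a list \<Rightarrow> 'a list set" where
  "eclass X E c = ehomotopy X E `` {c}"

definition based_chains :: "'a uspace \<Rightarrow> ('a \<times> 'a) set \<Rightarrow> 'a list set" where
  "based_chains X E = {c. echain X E c \<and> hd c = base X}"

definition based_loops :: "'a uspace \<Rightarrow> ('a \<times> 'a) set \<Rightarrow> 'a list set" where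
  "based_loops X E = {c \<in> based_chains X E. last c = base X}"

definition star_entourage ::
    "'a uspace \<Rightarrow> ('a \<times> 'a) set \<Rightarrow> ('a \<times> 'a) set \<Rightarrow> ('a list set \<times> 'a list set) set" where
  "star_entourage X E D =
     {(eclass X E (c @ [y]), eclass X E (c @ [z])) | c y z.
        c \<noteq> [] \<and> c @ [y] \<in> based_chains X E \<and> c @ [z] \<in> based_chains X E \<and> (y, z) \<in> D}"

text \<open>Since \<open>D \<mapsto> D\<^sup>*\<close> is monotone, the sets \<open>D\<^sup>*\<close> are downward directed, so the infimum of
  their principal filters is the filter having them as a base.\<close>

definition chain_space :: "'a uspace \<Rightarrow> ('a \<times> 'a) set \<Rightarrow> 'a list set uspace" where
  "chain_space X E =
     \<lparr>points = eclass X E ` based_chains X E,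
      unif = (INF D\<in>{D \<in> entourages X. D \<subseteq> E}. principal (star_entourage X E D)),
      base = eclass X E [base X]\<rparr>"

lemma entourages_Int:
  "D \<in> entourages X \<Longrightarrow> D' \<in> entourages X \<Longrightarrow> D \<inter> D' \<in> entourages X"
  unfolding entourages_def by (auto simp: eventually_conj_iff intro: sym_Int)

lemma eventually_chain_space:
  assumes "E \<in> entourages X"
  shows "eventually P (unif (chain_space X E)) \<longleftrightarrow>
    (\<exists>D\<in>entourages X. D \<subseteq> E \<and> (\<forall>p\<in>star_entourage X E D. P p))"
proof -
  let ?I = "{D \<in> entourages X. D \<subseteq> E}"
  have "eventually P (INF D\<in>?I. principal (star_entourage X E D)) \<longleftrightarrow>
      (\<exists>D\<in>?I. eventually P (principal (star_entourage X E D)))"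
  proof (rule eventually_INF_base)
    show "?I \<noteq> {}" using assms by auto
  next
    fix D D' assume "D \<in> ?I" "D' \<in> ?I"
    then have "D \<inter> D' \<in> ?I" by (auto intro: entourages_Int)
    moreover have "star_entourage X E (D \<inter> D') \<subseteq>
        star_entourage X E D \<inter> star_entourage X E D'"
      unfolding star_entourage_def by blast
    ultimately show "\<exists>x\<in>?I. principal (star_entourage X E x) \<le>
        inf (principal (star_entourage X E D)) (principal (star_entourage X E D'))"
      by (intro bexI[of _ "D \<inter> D'"]) auto
  qed
  then show ?thesis by (auto simp: chain_space_def eventually_principal)
qed

text \<open>The maps \<open>[\<alpha>]\<^sub>F \<mapsto> [\<alpha>]\<^sub>E\<close> and \<open>[\<alpha>]\<^sub>E \<mapsto> last \<alpha>\<close> and the product \<open>[\<alpha>]\<^sub>E [\<beta>]\<^sub>E = [\<alpha> * \<beta>]\<^sub>E\<close>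
  do not depend on the representatives; the singleton unions and images below collapse
  accordingly.\<close>

definition bonding :: "'a uspace \<Rightarrow> ('a \<times> 'a) set \<Rightarrow> 'a list set \<Rightarrow> 'a list set" where
  "bonding X E A = (\<Union>c\<in>A. eclass X E c)"

definition endpoint :: "'a list set \<Rightarrow> 'a" where
  "endpoint A = the_elem (last ` A)"

lemma ehomotopy_last: "(c, d) \<in> ehomotopy X E \<Longrightarrow> last d = last c"
  unfolding ehomotopy_def
  by (induction rule: rtrancl_induct) (auto simp: insertion_def)

lemma endpoint_eclass: "endpoint (eclass X E c) = last c"
proof -
  have "(c, c) \<in> ehomotopy X E" by (simp add: ehomotopy_def)
  then have "last ` eclass X E c = {last c}"
    unfolding eclass_def using ehomotopy_last by fastforce
  then show ?thesis by (simp add: endpoint_def)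
qed

lemma insertion_mono: "F \<subseteq> E \<Longrightarrow> insertion X F \<subseteq> insertion X E"
  unfolding insertion_def echain_def
  by (auto elim: successively_mono)

lemma ehomotopy_mono: "F \<subseteq> E \<Longrightarrow> ehomotopy X F \<subseteq> ehomotopy X E"
  unfolding ehomotopy_def using insertion_mono by (intro rtrancl_mono) blast

lemma ehomotopy_equiv: "equiv UNIV (ehomotopy X E)"
  unfolding ehomotopy_def
  by (intro equivI refl_rtrancl trans_rtrancl sym_rtrancl) (auto simp: sym_def)

lemma bonding_eclass:
  assumes "F \<subseteq> E"
  shows "bonding X E (eclass X F c) = eclass X E c"
proof -
  have "eclass X E d = eclass X E c" if "d \<in> eclass X F c" for d
    using that ehomotopy_mono[OF assms, of X] equiv_class_eq[OF ehomotopy_equiv, of c d X E]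
    by (auto simp: eclass_def)
  moreover have "c \<in> eclass X F c" by (simp add: eclass_def ehomotopy_def)
  ultimately show ?thesis unfolding bonding_def by blast
qed

definition econcat ::
    "'a uspace \<Rightarrow> ('a \<times> 'a) set \<Rightarrow> 'a list set \<Rightarrow> 'a list set \<Rightarrow> 'a list set" where
  "econcat X E A B = (\<Union>c\<in>A. \<Union>d\<in>B. eclass X E (c @ tl d))"

definition deck_group :: "'a uspace \<Rightarrow> ('a \<times> 'a) set \<Rightarrow> 'a list set monoid" where
  "deck_group X E =
     \<lparr>carrier = eclass X E ` based_loops X E,
      monoid.mult = econcat X E,
      one = eclass X E [base X]\<rparr>"


section \<open>The inverse limits\<close>

definition utilde :: "'a uspace \<Rightarrow> (('a \<times> 'a) set \<Rightarrow> 'a list set) uspace" where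
  "utilde X =
     (let P = {x \<in> \<Pi>\<^sub>E E\<in>entourages X. points (chain_space X E).
                 \<forall>E\<in>entourages X. \<forall>F\<in>entourages X. F \<subseteq> E \<longrightarrow> bonding X E (x F) = x E}
      in \<lparr>points = P,
          unif = inf (INF E\<in>entourages X.
                        filtercomap (map_prod (\<lambda>x. x E) (\<lambda>x. x E)) (unif (chain_space X E)))
                     (principal (P \<times> P)),
          base = (\<lambda>E\<in>entourages X. base (chain_space X E))\<rparr>)"

text \<open>The projection to \<open>X\<close>, which is identified with \<open>X\<^sub>E\<close> for \<open>E = X \<times> X\<close> via endpoints.\<close>

definition uproj :: "'a uspace \<Rightarrow> (('a \<times> 'a) set \<Rightarrow> 'a list set) \<Rightarrow> 'a" where
  "uproj X x = endpoint (x (points X \<times> points X))"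

definition coverable :: "'a uspace \<Rightarrow> bool" where
  "coverable X \<longleftrightarrow>
     (\<exists>\<B> \<subseteq> entourages X.
        (\<forall>E\<in>entourages X. \<exists>B\<in>\<B>. B \<subseteq> E) \<and>
        points X \<times> points X \<in> \<B> \<and>
        (\<forall>E\<in>\<B>. (\<lambda>x. x E) ` points (utilde X) = points (chain_space X E)))"

definition delta1 :: "'a uspace \<Rightarrow> (('a \<times> 'a) set \<Rightarrow> 'a list set) monoid" where
  "delta1 X = product_group (entourages X) (deck_group X)
     \<lparr>carrier := {g \<in> \<Pi>\<^sub>E E\<in>entourages X. carrier (deck_group X E).
        \<forall>E\<in>entourages X. \<forall>F\<in>entourages X. F \<subseteq> E \<longrightarrow> bonding X E (g F) = g E}\<rparr>"

text \<open>Elements of \<open>\<delta>\<^sub>1(X)\<close> are points of the inverse limit, so lifts apply to them.\<close>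

lemma delta1_eq_fibre:
  assumes "points X \<times> points X \<in> entourages X"
  shows "carrier (delta1 X) = {x \<in> points (utilde X). uproj X x = base X}"
proof -
  let ?T = "points X \<times> points X"
  have pts: "points (chain_space X E) = eclass X E ` based_chains X E" for E
    by (simp add: chain_space_def)
  have car: "carrier (deck_group X E) =
      {A \<in> points (chain_space X E). endpoint A = base X}" for E
    unfolding pts by (auto simp: deck_group_def based_loops_def endpoint_eclass)
  have endp: "endpoint (x E) = uproj X x" if x: "x \<in> points (utilde X)" and E: "E \<in> entourages X"
    for x E
  proof -
    from E have "E \<subseteq> ?T" by (simp add: entourages_def)
    with x E assms have b: "bonding X ?T (x E) = x ?T"
      by (simp add: utilde_def Let_def)
    from x E have "x E \<in> points (chain_space X E)"
      by (auto simp: utilde_def Let_def)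
    then obtain c where "x E = eclass X E c" unfolding pts by auto
    with b bonding_eclass[OF \<open>E \<subseteq> ?T\<close>, of X c] show ?thesis
      unfolding uproj_def by (metis endpoint_eclass)
  qed
  show ?thesis
  proof (intro equalityI subsetI)
    fix x assume x: "x \<in> carrier (delta1 X)"
    then have "x \<in> points (utilde X)"
      by (auto simp: delta1_def utilde_def Let_def car PiE_iff)
    moreover have "uproj X x = base X"
      using x assms by (auto simp: delta1_def car uproj_def PiE_iff)
    ultimately show "x \<in> {x \<in> points (utilde X). uproj X x = base X}" by simp
  next
    fix x assume x: "x \<in> {x \<in> points (utilde X). uproj X x = base X}"
    with endp have "\<forall>E\<in>entourages X. endpoint (x E) = base X" by simp
    with x show "x \<in> carrier (delta1 X)"
      by (auto simp: delta1_def utilde_def Let_def car PiE_iff)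
  qed
qed

definition delta1_action ::
    "'a uspace \<Rightarrow> (('a \<times> 'a) set \<Rightarrow> 'a list set) \<Rightarrow> (('a \<times> 'a) set \<Rightarrow> 'a list set) \<Rightarrow>
      (('a \<times> 'a) set \<Rightarrow> 'a list set)" where
  "delta1_action X g x = (\<lambda>E\<in>entourages X. econcat X E (g E) (x E))"


section \<open>Lifts\<close>

definition lifts ::
    "'a uspace \<Rightarrow> 'b uspace \<Rightarrow> ('a \<Rightarrow> 'b) \<Rightarrow>
      ((('a \<times> 'a) set \<Rightarrow> 'a list set) \<Rightarrow> (('b \<times> 'b) set \<Rightarrow> 'b list set)) set" where
  "lifts X Y f =
     {h \<in> extensional (points (utilde X)).
        ucontinuous (utilde X) (utilde Y) h \<and>
        h (base (utilde X)) = base (utilde Y) \<and>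
        (\<forall>x\<in>points (utilde X). f (uproj X x) = uproj Y (h x))}"

definition lift ::
    "'a uspace \<Rightarrow> 'b uspace \<Rightarrow> ('a \<Rightarrow> 'b) \<Rightarrow>
      (('a \<times> 'a) set \<Rightarrow> 'a list set) \<Rightarrow> (('b \<times> 'b) set \<Rightarrow> 'b list set)" where
  "lift X Y f = (THE h. h \<in> lifts X Y f)"

definition lift_star ::
    "'a uspace \<Rightarrow> 'b uspace \<Rightarrow> ('a \<Rightarrow> 'b) \<Rightarrow>
      (('a \<times> 'a) set \<Rightarrow> 'a list set) \<Rightarrow> (('b \<times> 'b) set \<Rightarrow> 'b list set)" where
  "lift_star X Y f = restrict (lift X Y f) (carrier (delta1 X))"


section \<open>Discrete covers\<close>

definition orbit_of :: "('a \<Rightarrow> 'a) set \<Rightarrow> 'a \<Rightarrow> 'a set" where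
  "orbit_of G x = (\<lambda>g. g x) ` G"

definition quotient_space :: "'a uspace \<Rightarrow> ('a \<Rightarrow> 'a) set \<Rightarrow> 'a set uspace" where
  "quotient_space X G =
     \<lparr>points = orbit_of G ` points X,
      unif = filtermap (map_prod (orbit_of G) (orbit_of G)) (unif X),
      base = orbit_of G (base X)\<rparr>"

definition discrete_action :: "'a uspace \<Rightarrow> ('a \<Rightarrow> 'a) set \<Rightarrow> bool" where
  "discrete_action X G \<longleftrightarrow>
     subgroup G (BijGroup (points X)) \<and>
     (\<forall>g\<in>G. uhomeomorphism X X g) \<and>
     (\<forall>E\<in>entourages X. \<exists>F\<in>entourages X. F \<subseteq> E \<and> (\<forall>g\<in>G. map_prod g g ` F = F)) \<and>
     (\<exists>E\<in>entourages X. \<forall>g\<in>G. (\<exists>x\<in>points X. (g x, x) \<in> E) \<longrightarrow> g = \<one>\<^bsub>BijGroup (points X)\<^esub>)"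

definition discrete_cover :: "'a uspace \<Rightarrow> 'b uspace \<Rightarrow> ('a \<Rightarrow> 'b) \<Rightarrow> bool" where
  "discrete_cover X Y f \<longleftrightarrow>
     (\<exists>G h. discrete_action X G \<and> uhomeomorphism (quotient_space X G) Y h \<and>
        (\<forall>x\<in>points X. f x = h (orbit_of G x)))"

end

theory Submission
  imports Defs
begin

text \<open>
  Everything is read off from chains.  A uniformly continuous based map \<open>f\<close> sends an
  \<open>f\<^sup>-\<^sup>1(E)\<close>-chain to an \<open>E\<close>-chain and respects insertions of points, so it induces maps from
  \<open>X\<close>'s classes at scale \<open>f\<^sup>-\<^sup>1(E)\<close> to \<open>Y\<close>'s classes at scale \<open>E\<close>.  Together these form a lift of
  \<open>f\<close>, and its equivariance under the deck group is the fact that mapping chains preserves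
  concatenation.

  Uniqueness rests on two observations.  Two classes that both extend a given class by one
  step are equal as soon as their endpoints agree.  Hence two lifts of the same map that agree
  at one point in the coordinate \<open>E\<close> agree there at every sufficiently close point.  And the
  inverse limit of a coverable space is chain connected, because surjectivity of the
  projections \<open>\<phi>\<^sub>E\<close> for a base of entourages allows the initial segments of a representing chain to be realised by points.  So
  the lifts agree everywhere (\<open>coverable_chain_induct\<close>, \<open>lifts_unique\<close>).  Compatibility with
  composition follows, since a composite of lifts is a lift.

  If \<open>f\<close> is the quotient by a discrete action, there are arbitrarily small invariant
  entourages \<open>F\<close> such that each \<open>f(F)\<close>-step lifts uniquely to an \<open>F\<close>-step with given starting
  point, and points in the same fibre are equal if three \<open>F\<close>-steps join them
  (\<open>discrete_cover_lifting_entourages\<close>).  Then \<open>f(F)\<close>-chains lift uniquely, and so do homotopies: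
  an insertion replaces one step by two, and the new lift closes up because the discrepancy
  spans three steps (\<open>insertion_lift\<close>).  Thus classes at scale \<open>F\<close> in \<open>X\<close> correspond
  bijectively to classes at scale \<open>f(F)\<close> in \<open>Y\<close>, with neighbours corresponding to neighbours,
  and the lift of \<open>f\<close>, a limit of such bijections, is a uniform homeomorphism
  (\<open>ulift_uhomeomorphism\<close>).
\<close>


section \<open>Entourages\<close>

lemma entourage_subset: "E \<in> entourages X \<Longrightarrow> E \<subseteq> points X \<times> points X"
  by (simp add: entourages_def)

lemma entourage_sym: "E \<in> entourages X \<Longrightarrow> (x, y) \<in> E \<Longrightarrow> (y, x) \<in> E"
  by (auto simp: entourages_def dest: symD)

lemma entourage_refl:
  "pointed_uniform_space X \<Longrightarrow> E \<in> entourages X \<Longrightarrow> x \<in> points X \<Longrightarrow> (x, x) \<in> E"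
  by (auto simp: entourages_def pointed_uniform_space_def)

lemma eventually_on_points:
  "pointed_uniform_space X \<Longrightarrow> eventually (\<lambda>p. p \<in> points X \<times> points X) (unif X)"
  unfolding pointed_uniform_space_def
  by (auto simp: le_principal)

lemma total_entourage:
  "pointed_uniform_space X \<Longrightarrow> points X \<times> points X \<in> entourages X"
  using eventually_on_points[of X] by (auto simp: entourages_def sym_def)

lemma symmetrised_entourage:
  assumes X: "pointed_uniform_space X" and Q: "eventually Q (unif X)"
  shows "{(x, y) \<in> points X \<times> points X. Q (x, y) \<and> Q (y, x)} \<in> entourages X"
proof -
  have "eventually (\<lambda>(x, y). Q (y, x)) (unif X)"
    using X Q by (simp add: pointed_uniform_space_def)
  with Q eventually_on_points[OF X]
  have "eventually (\<lambda>p. p \<in> {(x, y) \<in> points X \<times> points X. Q (x, y) \<and> Q (y, x)}) (unif X)"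
    by eventually_elim auto
  then show ?thesis by (auto simp: entourages_def sym_def)
qed

lemma entourage_half:
  assumes X: "pointed_uniform_space X" and E: "E \<in> entourages X"
  shows "\<exists>H\<in>entourages X. H O H \<subseteq> E"
proof -
  have "eventually (\<lambda>p. p \<in> E) (unif X)" using E by (simp add: entourages_def)
  then have "\<exists>Q. eventually Q (unif X) \<and> (\<forall>x y z. Q (x, y) \<longrightarrow> Q (y, z) \<longrightarrow> (x, z) \<in> E)"
    using X[unfolded pointed_uniform_space_def, THEN conjunct2, THEN conjunct2,
        THEN spec[of _ "\<lambda>p. p \<in> E"]]
    by blast
  then obtain Q where Q: "eventually Q (unif X)"
    and tr: "\<And>x y z. Q (x, y) \<Longrightarrow> Q (y, z) \<Longrightarrow> (x, z) \<in> E"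
    by blast
  show ?thesis
    by (intro bexI[OF _ symmetrised_entourage[OF X Q]]) (blast intro: tr)
qed

lemma entourage_third:
  assumes X: "pointed_uniform_space X" and E: "E \<in> entourages X"
  shows "\<exists>H\<in>entourages X. H O H O H \<subseteq> E"
proof -
  obtain A where A: "A \<in> entourages X" "A O A \<subseteq> E"
    using entourage_half[OF X E] by blast
  obtain H where H: "H \<in> entourages X" "H O H \<subseteq> A"
    using entourage_half[OF X A(1)] by blast
  have "H \<subseteq> A"
  proof
    fix p assume "p \<in> H"
    moreover from this have "(fst p, fst p) \<in> H"
      using entourage_subset[OF H(1)] by (intro entourage_refl[OF X H(1)]) (cases p; auto)
    ultimately show "p \<in> A" using H(2) by (cases p) auto
  qed
  with A(2) H(2) have "H O H O H \<subseteq> E" by blast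
  with H(1) show ?thesis by blast
qed

definition pullback :: "'a uspace \<Rightarrow> ('a \<Rightarrow> 'b) \<Rightarrow> ('b \<times> 'b) set \<Rightarrow> ('a \<times> 'a) set" where
  "pullback X f E = {(x, y) \<in> points X \<times> points X. (f x, f y) \<in> E}"

lemma pullback_mono: "F \<subseteq> E \<Longrightarrow> pullback X f F \<subseteq> pullback X f E"
  by (auto simp: pullback_def)

lemma pullback_entourage:
  assumes X: "pointed_uniform_space X" and f: "ucontinuous X Y f" and E: "E \<in> entourages Y"
  shows "pullback X f E \<in> entourages X"
proof -
  have "eventually (\<lambda>p. p \<in> E) (unif Y)" using E by (simp add: entourages_def)
  with f have "eventually (\<lambda>p. map_prod f f p \<in> E) (unif X)"
    by (auto simp: ucontinuous_def filterlim_iff)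
  with eventually_on_points[OF X] have "eventually (\<lambda>p. p \<in> pullback X f E) (unif X)"
    by eventually_elim (auto simp: pullback_def)
  moreover have "sym (pullback X f E)"
    using entourage_sym[OF E] by (auto simp: pullback_def sym_def)
  ultimately show ?thesis by (auto simp: entourages_def pullback_def)
qed


section \<open>Chains and homotopies\<close>

lemma ehomotopy_refl: "(c, c) \<in> ehomotopy X E"
  by (simp add: ehomotopy_def)

lemma ehomotopy_sym: "(c, d) \<in> ehomotopy X E \<Longrightarrow> (d, c) \<in> ehomotopy X E"
  using ehomotopy_equiv[of X E] by (auto simp: equiv_def dest: symD)

lemma ehomotopy_trans:
  "(c, d) \<in> ehomotopy X E \<Longrightarrow> (d, e) \<in> ehomotopy X E \<Longrightarrow> (c, e) \<in> ehomotopy X E"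
  by (auto simp: ehomotopy_def)

lemma insertionI:
  "echain X E c \<Longrightarrow> echain X E d \<Longrightarrow> hd c = hd d \<Longrightarrow> last c = last d \<Longrightarrow>
    c = us @ vs \<Longrightarrow> d = us @ x # vs \<Longrightarrow> (c, d) \<in> insertion X E"
  unfolding insertion_def by blast

lemma insertionE:
  assumes "(c, d) \<in> insertion X E"
  obtains us x vs where "c = us @ vs" "d = us @ x # vs" "echain X E c" "echain X E d"
    "hd c = hd d" "last c = last d" "c \<noteq> []" "d \<noteq> []"
proof -
  from assms obtain us x vs where "c = us @ vs" "d = us @ x # vs" "echain X E c" "echain X E d"
    "hd c = hd d" "last c = last d"
    unfolding insertion_def by blast
  moreover from this have "c \<noteq> []" "d \<noteq> []" by (simp_all add: echain_def)
  ultimately show ?thesis by (rule that)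
qed

lemma insertion_ehomotopy: "(c, d) \<in> insertion X E \<Longrightarrow> (c, d) \<in> ehomotopy X E"
  by (auto simp: ehomotopy_def)

lemma eclass_eq_iff: "eclass X E c = eclass X E d \<longleftrightarrow> (c, d) \<in> ehomotopy X E"
  unfolding eclass_def using eq_equiv_class_iff[OF ehomotopy_equiv, of c d] by simp

lemma mem_eclass: "d \<in> eclass X E c \<longleftrightarrow> (c, d) \<in> ehomotopy X E"
  by (simp add: eclass_def)

lemma ehomotopy_echain_hd:
  "(c, d) \<in> ehomotopy X E \<Longrightarrow> echain X E c \<Longrightarrow> echain X E d \<and> hd d = hd c"
  unfolding ehomotopy_def
  by (induction rule: rtrancl_induct) (auto simp: insertion_def)

lemma ehomotopy_based:
  "(c, d) \<in> ehomotopy X E \<Longrightarrow> c \<in> based_chains X E \<Longrightarrow> d \<in> based_chains X E"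
  using ehomotopy_echain_hd by (auto simp: based_chains_def)

text \<open>A map of chains respects homotopy as soon as it does so for single insertions; only
  chains with the endpoints of the given ones occur on the way.\<close>

lemma ehomotopy_map:
  assumes "(c, d) \<in> ehomotopy X E"
    and ins: "\<And>a b. (a, b) \<in> insertion X E \<Longrightarrow> hd a = hd c \<Longrightarrow> last a = last c \<Longrightarrow>
      (F a, F b) \<in> ehomotopy Y E'"
  shows "(F c, F d) \<in> ehomotopy Y E'"
proof -
  have "(F c, F d) \<in> ehomotopy Y E' \<and> hd d = hd c \<and> last d = last c"
    using assms(1) unfolding ehomotopy_def[of X E]
  proof (induction rule: rtrancl_induct)
    case base
    then show ?case by (simp add: ehomotopy_refl)
  next
    case (step a b)
    from step.hyps(2) have eq: "hd b = hd a" "last b = last a"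
      by (auto simp: insertion_def)
    with step ins[of a b] ins[of b a] have "(F a, F b) \<in> ehomotopy Y E'"
      by (auto dest: ehomotopy_sym)
    with step.IH eq show ?case by (auto intro: ehomotopy_trans)
  qed
  then show ?thesis ..
qed

lemma echain_append:
  "c \<noteq> [] \<Longrightarrow> d \<noteq> [] \<Longrightarrow>
    echain X E (c @ d) \<longleftrightarrow> echain X E c \<and> echain X E d \<and> (last c, hd d) \<in> E"
  by (auto simp: echain_def successively_append_iff)

lemma echain_Cons:
  "d \<noteq> [] \<Longrightarrow> echain X E (x # d) \<longleftrightarrow> x \<in> points X \<and> echain X E d \<and> (x, hd d) \<in> E"
  using echain_append[of "[x]" d X E] by (auto simp: echain_def)

lemma echain_single: "echain X E [x] \<longleftrightarrow> x \<in> points X"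
  by (simp add: echain_def)

lemma echain_hd_last: "echain X E c \<Longrightarrow> hd c \<in> points X \<and> last c \<in> points X"
  by (auto simp: echain_def)

lemma echain_mono: "F \<subseteq> E \<Longrightarrow> echain X F c \<Longrightarrow> echain X E c"
  unfolding echain_def by (auto elim: successively_mono)

lemma based_chains_mono: "F \<subseteq> E \<Longrightarrow> based_chains X F \<subseteq> based_chains X E"
  by (auto simp: based_chains_def intro: echain_mono)

lemma echain_concat:
  "echain X E c \<Longrightarrow> echain X E d \<Longrightarrow> last c = hd d \<Longrightarrow> echain X E (c @ tl d)"
  by (cases d; cases "tl d") (auto simp: echain_append echain_Cons echain_def[of _ _ c])

lemma last_concat: "c \<noteq> [] \<Longrightarrow> d \<noteq> [] \<Longrightarrow> last c = hd d \<Longrightarrow> last (c @ tl d) = last d"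
  by (cases d) auto

lemma ehomotopy_concat_left:
  assumes "(c, c') \<in> ehomotopy X E" "echain X E d" "last c = hd d"
  shows "(c @ tl d, c' @ tl d) \<in> ehomotopy X E"
proof (rule ehomotopy_map[OF assms(1)])
  fix a b assume ab: "(a, b) \<in> insertion X E" and "last a = last c"
  with assms(3) have l: "last a = hd d" "last b = hd d" by (auto simp: insertion_def)
  from ab obtain us x vs where eq: "a = us @ vs" "b = us @ x # vs"
    and chains: "echain X E a" "echain X E b" and hds: "hd a = hd b"
    and ne: "a \<noteq> []" "b \<noteq> []"
    by (rule insertionE)
  have d: "d \<noteq> []" using assms(2) by (auto simp: echain_def)
  have "(a @ tl d, b @ tl d) \<in> insertion X E"
  proof (rule insertionI)
    show "echain X E (a @ tl d)" "echain X E (b @ tl d)"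
      using echain_concat[OF chains(1) assms(2) l(1)] echain_concat[OF chains(2) assms(2) l(2)] .
    show "last (a @ tl d) = last (b @ tl d)"
      using last_concat ne d l by metis
    show "hd (a @ tl d) = hd (b @ tl d)" using hds ne by simp
    show "a @ tl d = us @ (vs @ tl d)" "b @ tl d = us @ x # (vs @ tl d)"
      using eq by simp_all
  qed
  then show "(a @ tl d, b @ tl d) \<in> ehomotopy X E" by (rule insertion_ehomotopy)
qed

text \<open>An insertion may repeat the first point of the second chain.  In the concatenation this
  becomes the insertion of the common endpoint of the two chains.\<close>

lemma ehomotopy_concat_right:
  assumes "(d, d') \<in> ehomotopy X E" "echain X E c" "last c = hd d"
  shows "(c @ tl d, c @ tl d') \<in> ehomotopy X E"
proof (rule ehomotopy_map[OF assms(1)])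
  fix a b assume ab: "(a, b) \<in> insertion X E" and "hd a = hd d"
  with assms(3) have l: "last c = hd a" "last c = hd b" by (auto simp: insertion_def)
  from ab obtain us x vs where eq: "a = us @ vs" "b = us @ x # vs"
    and chains: "echain X E a" "echain X E b" and lasts: "last a = last b" and hds: "hd a = hd b"
    and ne: "a \<noteq> []" "b \<noteq> []"
    by (rule insertionE)
  have c: "c \<noteq> []" using assms(2) by (auto simp: echain_def)
  have "\<exists>us' x' vs'. tl a = us' @ vs' \<and> tl b = us' @ x' # vs'"
  proof (cases us)
    case Nil
    with eq ne hds have "tl a = [] @ tl a" "tl b = [] @ x # tl a" by (cases vs; auto)+
    then show ?thesis by blast
  next
    case (Cons u us')
    with eq show ?thesis by auto
  qed
  then obtain us' x' vs' where "tl a = us' @ vs'" "tl b = us' @ x' # vs'" by blast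
  then have tls: "c @ tl a = (c @ us') @ vs'" "c @ tl b = (c @ us') @ x' # vs'" by simp_all
  have "(c @ tl a, c @ tl b) \<in> insertion X E"
  proof (rule insertionI[OF _ _ _ _ tls])
    show "echain X E (c @ tl a)" "echain X E (c @ tl b)"
      using echain_concat[OF assms(2) chains(1) l(1)] echain_concat[OF assms(2) chains(2) l(2)] .
    show "last (c @ tl a) = last (c @ tl b)"
      using last_concat ne c l lasts by metis
    show "hd (c @ tl a) = hd (c @ tl b)" using c by simp
  qed
  then show "(c @ tl a, c @ tl b) \<in> ehomotopy X E" by (rule insertion_ehomotopy)
qed

lemma econcat_eclass:
  assumes "echain X E c" "echain X E d" "last c = hd d"
  shows "econcat X E (eclass X E c) (eclass X E d) = eclass X E (c @ tl d)"
proof -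
  have "eclass X E (c' @ tl d') = eclass X E (c @ tl d)"
    if "c' \<in> eclass X E c" "d' \<in> eclass X E d" for c' d'
  proof -
    have c': "(c, c') \<in> ehomotopy X E" and d': "(d, d') \<in> ehomotopy X E"
      using that by (simp_all add: mem_eclass)
    have "(c @ tl d, c' @ tl d) \<in> ehomotopy X E"
      by (rule ehomotopy_concat_left[OF c' assms(2,3)])
    moreover have "(c' @ tl d, c' @ tl d') \<in> ehomotopy X E"
      using ehomotopy_concat_right[OF d'] ehomotopy_echain_hd[OF c' assms(1)]
        ehomotopy_last[OF c'] assms(3) by auto
    ultimately show ?thesis
      unfolding eclass_eq_iff by (meson ehomotopy_sym ehomotopy_trans)
  qed
  moreover have "c \<in> eclass X E c" "d \<in> eclass X E d"
    by (simp_all add: mem_eclass ehomotopy_refl)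
  ultimately show ?thesis unfolding econcat_def by blast
qed

lemma echain_map:
  assumes "echain X F c" "f \<in> points X \<rightarrow> points Y" "map_prod f f ` F \<subseteq> E"
  shows "echain Y E (map f c)"
  using assms unfolding echain_def successively_map
  by (auto elim!: successively_mono)

lemma ehomotopy_map_chain:
  assumes "(c, d) \<in> ehomotopy X F" "f \<in> points X \<rightarrow> points Y" "map_prod f f ` F \<subseteq> E"
  shows "(map f c, map f d) \<in> ehomotopy Y E"
proof (rule ehomotopy_map[OF assms(1)])
  fix a b assume ab: "(a, b) \<in> insertion X F"
  then obtain us x vs where eq: "a = us @ vs" "b = us @ x # vs"
    and chains: "echain X F a" "echain X F b" and ends: "hd a = hd b" "last a = last b"
    and ne: "a \<noteq> []" "b \<noteq> []"
    by (rule insertionE)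
  have "(map f a, map f b) \<in> insertion Y E"
  proof (rule insertionI)
    show "echain Y E (map f a)" "echain Y E (map f b)"
      using echain_map[OF _ assms(2,3)] chains by auto
    show "hd (map f a) = hd (map f b)" "last (map f a) = last (map f b)"
      using ends ne by (simp_all add: hd_map last_map)
    show "map f a = map f us @ map f vs" "map f b = map f us @ f x # map f vs"
      using eq by simp_all
  qed
  then show "(map f a, map f b) \<in> ehomotopy Y E" by (rule insertion_ehomotopy)
qed

lemma base_chain: "pointed_uniform_space X \<Longrightarrow> [base X] \<in> based_chains X E"
  by (simp add: based_chains_def echain_single pointed_uniform_space_def)

lemma ehomotopy_repeat_last:
  assumes "pointed_uniform_space X" "E \<in> entourages X" "echain X E c"
  shows "(c, c @ [last c]) \<in> ehomotopy X E"
proof -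
  have "c \<noteq> []" "last c \<in> points X" using assms(3) by (auto simp: echain_def)
  then have "echain X E (c @ [last c])"
    using assms entourage_refl[OF assms(1,2)] by (simp add: echain_append echain_single)
  then have "(c, c @ [last c]) \<in> insertion X E"
    using assms(3) \<open>c \<noteq> []\<close>
    by (intro insertionI[where us = c and x = "last c" and vs = "[]"]) auto
  then show ?thesis by (rule insertion_ehomotopy)
qed

text \<open>For \<open>D = E\<close> the relation \<open>D\<^sup>*\<close> says that the second class arises from the first one by
  adding one step: a pair \<open>[c, y], [c, z]\<close> is the same as \<open>[c, y], [c, y, z]\<close>.\<close>

lemma star_entourage_self:
  assumes X: "pointed_uniform_space X" and E: "E \<in> entourages X"
  shows "star_entourage X E E =
    {(eclass X E c, eclass X E (c @ [z])) | c z. c \<in> based_chains X E \<and> c @ [z] \<in> based_chains X E}"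
    (is "_ = ?R")
proof (intro equalityI subsetI)
  fix p assume "p \<in> star_entourage X E E"
  then obtain c y z where p: "p = (eclass X E (c @ [y]), eclass X E (c @ [z]))"
    and c: "c \<noteq> []" "c @ [y] \<in> based_chains X E" "c @ [z] \<in> based_chains X E" "(y, z) \<in> E"
    unfolding star_entourage_def by blast
  have yz: "(c @ [y]) @ [z] \<in> based_chains X E"
    using c by (auto simp: based_chains_def echain_append echain_Cons echain_single)
  then have "(c @ [z], (c @ [y]) @ [z]) \<in> insertion X E"
    using c
    by (intro insertionI[where us = c and x = y and vs = "[z]"]) (auto simp: based_chains_def)
  then have "eclass X E (c @ [z]) = eclass X E ((c @ [y]) @ [z])"
    unfolding eclass_eq_iff by (rule insertion_ehomotopy)
  with p c(2) yz show "p \<in> ?R" by blast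
next
  fix p assume "p \<in> ?R"
  then obtain c z where p: "p = (eclass X E c, eclass X E (c @ [z]))"
    and c: "c \<in> based_chains X E" "c @ [z] \<in> based_chains X E" by blast
  have ch: "echain X E c" and ne: "c \<noteq> []" using c by (auto simp: based_chains_def echain_def)
  have "(last c, z) \<in> E" using c(2) ne by (auto simp: based_chains_def echain_append)
  moreover have "(c, c @ [last c]) \<in> ehomotopy X E" by (rule ehomotopy_repeat_last[OF X E ch])
  moreover from this have "c @ [last c] \<in> based_chains X E" using ehomotopy_based c(1) by blast
  ultimately show "p \<in> star_entourage X E E"
    using c ne unfolding p star_entourage_def eclass_eq_iff[symmetric] by blast
qed

lemma star_entourage_bonding:
  assumes "F \<subseteq> E" "(A, B) \<in> star_entourage X F D" "D \<subseteq> D'"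
  shows "(bonding X E A, bonding X E B) \<in> star_entourage X E D'"
  using assms(2,3) based_chains_mono[OF assms(1), of X]
  unfolding star_entourage_def
  by (auto simp: bonding_eclass[OF assms(1)]) blast


section \<open>The inverse limit\<close>

lemma utilde_E:
  assumes "x \<in> points (utilde X)" "F \<in> entourages X"
  obtains c where "c \<in> based_chains X F"
    "\<And>E. E \<in> entourages X \<Longrightarrow> F \<subseteq> E \<Longrightarrow> x E = eclass X E c"
proof -
  have "x F \<in> points (chain_space X F)"
    using assms by (auto simp: utilde_def Let_def)
  then obtain c where c: "c \<in> based_chains X F" "x F = eclass X F c"
    by (auto simp: chain_space_def)
  have "x E = eclass X E c" if "E \<in> entourages X" "F \<subseteq> E" for E
  proof -
    have "bonding X E (x F) = x E"
      using assms that by (auto simp: utilde_def Let_def)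
    then show ?thesis using c(2) bonding_eclass[OF that(2)] by metis
  qed
  with c(1) show ?thesis by (rule that)
qed

lemma utilde_representatives:
  assumes x: "x \<in> points (utilde X)"
  obtains c where "\<And>F. F \<in> entourages X \<Longrightarrow> c F \<in> based_chains X F"
    "\<And>F E. F \<in> entourages X \<Longrightarrow> E \<in> entourages X \<Longrightarrow> F \<subseteq> E \<Longrightarrow> x E = eclass X E (c F)"
proof -
  have "\<forall>F\<in>entourages X. \<exists>c. c \<in> based_chains X F \<and>
      (\<forall>E\<in>entourages X. F \<subseteq> E \<longrightarrow> x E = eclass X E c)"
    using utilde_E[OF x] by metis
  then obtain c where "\<forall>F\<in>entourages X. c F \<in> based_chains X F \<and>
      (\<forall>E\<in>entourages X. F \<subseteq> E \<longrightarrow> x E = eclass X E (c F))"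
    by (rule bchoice[elim_format]) blast
  then show ?thesis by (intro that[of c]) auto
qed

text \<open>Conversely, a choice of chains at all scales that become homotopic at the coarser scales
  defines a point.\<close>

lemma utilde_I:
  assumes "\<And>E. E \<in> entourages X \<Longrightarrow> c E \<in> based_chains X E"
    and "\<And>E F. E \<in> entourages X \<Longrightarrow> F \<in> entourages X \<Longrightarrow> F \<subseteq> E \<Longrightarrow>
      (c F, c E) \<in> ehomotopy X E"
  shows "(\<lambda>E\<in>entourages X. eclass X E (c E)) \<in> points (utilde X)"
  using assms by (auto simp: utilde_def Let_def chain_space_def bonding_eclass eclass_eq_iff)

lemma utilde_extensional: "x \<in> points (utilde X) \<Longrightarrow> x \<in> extensional (entourages X)"
  by (auto simp: utilde_def Let_def PiE_def)

lemma utilde_eqI: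
  assumes "x \<in> points (utilde X)" "y \<in> points (utilde X)"
    and "\<And>E. E \<in> entourages X \<Longrightarrow> x E = y E"
  shows "x = y"
  using assms utilde_extensional by (blast intro: extensionalityI)

lemma base_utilde: "E \<in> entourages X \<Longrightarrow> base (utilde X) E = eclass X E [base X]"
  by (simp add: utilde_def Let_def chain_space_def)

lemma base_in_utilde: "pointed_uniform_space X \<Longrightarrow> base (utilde X) \<in> points (utilde X)"
  using utilde_I[of X "\<lambda>E. [base X]"] base_chain[of X]
  by (auto simp: ehomotopy_refl utilde_def Let_def chain_space_def)

lemma endpoint_utilde:
  assumes "pointed_uniform_space X" "x \<in> points (utilde X)" "E \<in> entourages X"
  shows "endpoint (x E) = uproj X x"
proof -
  obtain c where c: "\<And>E'. E' \<in> entourages X \<Longrightarrow> E \<subseteq> E' \<Longrightarrow> x E' = eclass X E' c"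
    using utilde_E[OF assms(2,3)] by metis
  from c[OF assms(3)] c[OF total_entourage[OF assms(1)] entourage_subset[OF assms(3)]]
  show ?thesis by (simp add: uproj_def endpoint_eclass)
qed

text \<open>A basic entourage of the inverse limit is given by a coordinate \<open>E\<close> and some \<open>D \<subseteq> E\<close>.
  Passing to the coordinate \<open>D\<close> makes it smaller, so the pairs whose \<open>E\<close>-coordinates lie in
  \<open>E\<^sup>*\<close> form a base.\<close>

lemma eventually_utilde:
  assumes X: "pointed_uniform_space X"
  shows "eventually P (unif (utilde X)) \<longleftrightarrow>
    (\<exists>E\<in>entourages X. \<forall>x\<in>points (utilde X). \<forall>y\<in>points (utilde X).
       (x E, y E) \<in> star_entourage X E E \<longrightarrow> P (x, y))"
    (is "_ \<longleftrightarrow> (\<exists>E\<in>_. ?Q E)")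
proof -
  let ?U = "points (utilde X)"
  let ?F = "\<lambda>E. filtercomap (map_prod (\<lambda>x. x E) (\<lambda>x. x E)) (unif (chain_space X E))"
  have unif: "unif (utilde X) = inf (INF E\<in>entourages X. ?F E) (principal (?U \<times> ?U))"
    by (simp add: utilde_def Let_def)
  show ?thesis
  proof
    assume "\<exists>E\<in>entourages X. ?Q E"
    then obtain E where E: "E \<in> entourages X" "?Q E" by blast
    then have "eventually (\<lambda>p. p \<in> star_entourage X E E) (unif (chain_space X E))"
      by (auto simp: eventually_chain_space)
    then have "eventually (\<lambda>p. map_prod (\<lambda>x. x E) (\<lambda>x. x E) p \<in> star_entourage X E E) (?F E)"
      by (rule eventually_filtercomapI)
    moreover have "unif (utilde X) \<le> ?F E"
      unfolding unif using E(1) by (intro le_infI1 INF_lower)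
    ultimately have *: "eventually (\<lambda>p. map_prod (\<lambda>x. x E) (\<lambda>x. x E) p \<in> star_entourage X E E)
        (unif (utilde X))"
      by (rule filter_leD[rotated])
    have "eventually (\<lambda>p. p \<in> ?U \<times> ?U) (unif (utilde X))"
      unfolding unif by (intro filter_leD[OF inf_le2]) (auto simp: eventually_principal)
    with * show "eventually P (unif (utilde X))"
      by eventually_elim (use E(2) in auto)
  next
    assume "eventually P (unif (utilde X))"
    then have ev: "eventually (\<lambda>p. p \<in> ?U \<times> ?U \<longrightarrow> P p) (INF E\<in>entourages X. ?F E)"
      by (simp add: unif eventually_inf_principal)
    have single: "\<exists>D\<in>entourages X. \<forall>x\<in>?U. \<forall>y\<in>?U.
        (x D, y D) \<in> star_entourage X D D \<longrightarrow> R (x, y)"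
      if R: "eventually R (?F E)" and E: "E \<in> entourages X" for R E
    proof -
      from R obtain S where S: "eventually S (unif (chain_space X E))"
        "\<And>x y. S (x E, y E) \<Longrightarrow> R (x, y)"
        by (fastforce simp: eventually_filtercomap)
      from S(1) obtain D where D: "D \<in> entourages X" "D \<subseteq> E"
        "\<And>p. p \<in> star_entourage X E D \<Longrightarrow> S p"
        unfolding eventually_chain_space[OF E] by blast
      have "R (x, y)" if "x \<in> ?U" "y \<in> ?U" "(x D, y D) \<in> star_entourage X D D" for x y
      proof -
        have "bonding X E (x D) = x E" "bonding X E (y D) = y E"
          using that D(1,2) E by (auto simp: utilde_def Let_def)
        with star_entourage_bonding[OF D(2) that(3) order_refl] S(2) D(3) show ?thesis by metis
      qed
      with D(1) show ?thesis by blast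
    qed
    \<comment> \<open>The infimum involves finitely many coordinates; their intersection is finer than each.\<close>
    show "\<exists>E\<in>entourages X. ?Q E"
    proof -
      from ev obtain I where I: "finite I" "I \<subseteq> entourages X"
        "eventually (\<lambda>p. p \<in> ?U \<times> ?U \<longrightarrow> P p) (INF E\<in>I. ?F E)"
        unfolding eventually_INF[of _ _ "entourages X"] by blast
      have "\<exists>D\<in>entourages X. \<forall>x\<in>?U. \<forall>y\<in>?U.
          (x D, y D) \<in> star_entourage X D D \<longrightarrow> R (x, y)"
        if "eventually R (INF E\<in>I. ?F E)" for R
        using I(1,2) that
      proof (induction I arbitrary: R rule: finite_induct)
        case empty
        then have "R p" for p by (cases p) simp
        then show ?case using total_entourage[OF X] by blast
      next
        case (insert E I)
        then obtain R1 R2 where R: "eventually R1 (?F E)" "eventually R2 (INF E\<in>I. ?F E)"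
          "\<And>p. R1 p \<Longrightarrow> R2 p \<Longrightarrow> R p"
          by (auto simp: eventually_inf)
        obtain D1 where D1: "D1 \<in> entourages X" "\<forall>x\<in>?U. \<forall>y\<in>?U.
            (x D1, y D1) \<in> star_entourage X D1 D1 \<longrightarrow> R1 (x, y)"
          using single[OF R(1)] insert.prems by auto
        obtain D2 where D2: "D2 \<in> entourages X" "\<forall>x\<in>?U. \<forall>y\<in>?U.
            (x D2, y D2) \<in> star_entourage X D2 D2 \<longrightarrow> R2 (x, y)"
          using insert.IH[OF _ R(2)] insert.prems by auto
        let ?D = "D1 \<inter> D2"
        have D: "?D \<in> entourages X" using D1 D2 by (auto intro: entourages_Int)
        have "R (x, y)" if "x \<in> ?U" "y \<in> ?U" "(x ?D, y ?D) \<in> star_entourage X ?D ?D" for x y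
        proof -
          have "bonding X D1 (x ?D) = x D1" "bonding X D1 (y ?D) = y D1"
            "bonding X D2 (x ?D) = x D2" "bonding X D2 (y ?D) = y D2"
            using that D D1(1) D2(1) by (auto simp: utilde_def Let_def)
          then have "(x D1, y D1) \<in> star_entourage X D1 D1" "(x D2, y D2) \<in> star_entourage X D2 D2"
            using star_entourage_bonding[OF _ that(3)] by (metis inf_le1, metis inf_le2)
          with D1(2) D2(2) that R(3) show ?thesis by blast
        qed
        with D show ?case by blast
      qed
      from this[OF I(3)] show ?thesis by auto
    qed
  qed
qed

lemma utilde_star_mono:
  assumes "x \<in> points (utilde X)" "y \<in> points (utilde X)"
    and "E \<in> entourages X" "F \<in> entourages X" "F \<subseteq> E"
    and "(x F, y F) \<in> star_entourage X F F"
  shows "(x E, y E) \<in> star_entourage X E E"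
proof -
  have "bonding X E (x F) = x E" "bonding X E (y F) = y E"
    using assms by (auto simp: utilde_def Let_def)
  with star_entourage_bonding[OF assms(5,6,5)] show ?thesis by simp
qed

text \<open>With \<open>star_entourage_self\<close> this reduces uniform continuity to chains and their extensions
  by one point.\<close>

lemma ucontinuous_utilde_iff:
  assumes X: "pointed_uniform_space X" and Y: "pointed_uniform_space Y"
  shows "ucontinuous (utilde X) (utilde Y) h \<longleftrightarrow>
    h \<in> points (utilde X) \<rightarrow> points (utilde Y) \<and>
    (\<forall>E\<in>entourages Y. \<exists>F\<in>entourages X. \<forall>x\<in>points (utilde X). \<forall>y\<in>points (utilde X).
       (x F, y F) \<in> star_entourage X F F \<longrightarrow> (h x E, h y E) \<in> star_entourage Y E E)"
    (is "_ \<longleftrightarrow> ?maps \<and> ?cont")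
proof -
  have "filterlim (map_prod h h) (unif (utilde Y)) (unif (utilde X)) \<longleftrightarrow> ?cont"
    if maps: ?maps
  proof
    assume lim: "filterlim (map_prod h h) (unif (utilde Y)) (unif (utilde X))"
    show ?cont
    proof
      fix E assume E: "E \<in> entourages Y"
      let ?P = "\<lambda>p. p \<in> points (utilde Y) \<times> points (utilde Y) \<longrightarrow>
        (fst p E, snd p E) \<in> star_entourage Y E E"
      have "eventually ?P (unif (utilde Y))"
        using E by (auto simp: eventually_utilde[OF Y])
      with lim have "eventually (\<lambda>p. ?P (map_prod h h p)) (unif (utilde X))"
        by (auto simp: filterlim_iff)
      then show "\<exists>F\<in>entourages X. \<forall>x\<in>points (utilde X). \<forall>y\<in>points (utilde X).
          (x F, y F) \<in> star_entourage X F F \<longrightarrow> (h x E, h y E) \<in> star_entourage Y E E"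
        unfolding eventually_utilde[OF X] using maps by (fastforce simp: Pi_iff)
    qed
  next
    assume cont: ?cont
    show "filterlim (map_prod h h) (unif (utilde Y)) (unif (utilde X))"
      unfolding filterlim_iff
    proof (intro allI impI)
      fix P assume "eventually P (unif (utilde Y))"
      then obtain E where E: "E \<in> entourages Y"
        "\<forall>x\<in>points (utilde Y). \<forall>y\<in>points (utilde Y).
          (x E, y E) \<in> star_entourage Y E E \<longrightarrow> P (x, y)"
        unfolding eventually_utilde[OF Y] by blast
      from cont E(1) obtain F where F: "F \<in> entourages X"
        "\<forall>x\<in>points (utilde X). \<forall>y\<in>points (utilde X).
          (x F, y F) \<in> star_entourage X F F \<longrightarrow> (h x E, h y E) \<in> star_entourage Y E E"
        by blast
      show "eventually (\<lambda>p. P (map_prod h h p)) (unif (utilde X))"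
        unfolding eventually_utilde[OF X]
        using F E(2) maps by (intro bexI[OF _ F(1)]) (auto simp: Pi_iff)
    qed
  qed
  then show ?thesis unfolding ucontinuous_def by blast
qed

text \<open>The inverse limit of a coverable space is chain connected: the initial segments of a
  chain representing the \<open>D\<close>-coordinate of a point are the \<open>D\<close>-coordinates of points, by
  surjectivity of \<open>\<phi>\<^sub>D\<close>, and consecutive ones are \<open>D\<^sup>*\<close>-close.\<close>

lemma coverable_chain_induct:
  assumes X: "pointed_uniform_space X" and cov: "coverable X" and F: "F \<in> entourages X"
    and base: "P (base (utilde X))"
    and step: "\<And>x y. x \<in> points (utilde X) \<Longrightarrow> y \<in> points (utilde X) \<Longrightarrow> P x \<Longrightarrow>
      (x F, y F) \<in> star_entourage X F F \<Longrightarrow> P y"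
    and x: "x \<in> points (utilde X)"
  shows "P x"
proof -
  from cov obtain \<B> where B: "\<B> \<subseteq> entourages X" "\<forall>E\<in>entourages X. \<exists>B\<in>\<B>. B \<subseteq> E"
    "\<forall>E\<in>\<B>. (\<lambda>x. x E) ` points (utilde X) = points (chain_space X E)"
    unfolding coverable_def by (elim exE conjE)
  from B(2) F obtain D where "D \<in> \<B>" and DF: "D \<subseteq> F" by (elim bspec[elim_format] bexE)
  with B have D: "D \<in> entourages X" "D \<subseteq> F"
    and surj: "(\<lambda>x. x D) ` points (utilde X) = points (chain_space X D)" by auto
  have next_pt: "P y" if "x \<in> points (utilde X)" "y \<in> points (utilde X)" "P x"
    "x D = eclass X D c" "y D = eclass X D (c @ [z])"
    "c \<in> based_chains X D" "c @ [z] \<in> based_chains X D" for x y c z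
  proof -
    have "(x D, y D) \<in> star_entourage X D D"
      using that unfolding star_entourage_self[OF X D(1)] by blast
    then show ?thesis
      using utilde_star_mono[OF that(1,2) F D] step that by blast
  qed
  have "P y" if "c \<in> based_chains X D" "y \<in> points (utilde X)" "y D = eclass X D c" for c y
    using that
  proof (induction c arbitrary: y rule: rev_induct)
    case Nil
    then show ?case by (simp add: based_chains_def echain_def)
  next
    case (snoc z c)
    show ?case
    proof (cases "c = []")
      case True
      with snoc.prems have z: "z = base X" by (simp add: based_chains_def)
      let ?b = "[base X]"
      have b: "?b \<in> based_chains X D" by (rule base_chain[OF X])
      then have hom: "(?b, ?b @ [base X]) \<in> ehomotopy X D"
        using ehomotopy_repeat_last[OF X D(1), of ?b] by (simp add: based_chains_def)
      then have "y D = eclass X D (?b @ [base X])"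
        using snoc.prems(3) z True by (simp add: eclass_eq_iff)
      then show ?thesis
        by (rule next_pt[OF base_in_utilde[OF X] snoc.prems(2) base base_utilde[OF D(1)]])
          (fact b ehomotopy_based[OF hom b])+
    next
      case False
      with snoc.prems(1) have c: "c \<in> based_chains X D"
        by (auto simp: based_chains_def echain_append)
      then have "eclass X D c \<in> (\<lambda>x. x D) ` points (utilde X)"
        unfolding surj by (simp add: chain_space_def)
      then obtain x where x: "x \<in> points (utilde X)" "x D = eclass X D c" by auto
      with snoc.IH c have "P x" by blast
      with x c snoc.prems show ?thesis using next_pt by blast
    qed
  qed
  moreover obtain c where "c \<in> based_chains X D" "x D = eclass X D c"
    using utilde_E[OF x D(1)] D(1) by (metis order_refl)
  ultimately show ?thesis using x by blast
qed


section \<open>Uniqueness of lifts\<close>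

text \<open>Both neighbours extend chains of one class by the same point, and concatenation respects
  homotopy.\<close>

lemma star_entourage_determined:
  assumes X: "pointed_uniform_space X" and E: "E \<in> entourages X"
    and AB: "(A, B) \<in> star_entourage X E E" and AB': "(A, B') \<in> star_entourage X E E"
    and eq: "endpoint B = endpoint B'"
  shows "B = B'"
proof -
  obtain c z where c: "c @ [z] \<in> based_chains X E" "c \<in> based_chains X E"
    "A = eclass X E c" "B = eclass X E (c @ [z])"
    using AB unfolding star_entourage_self[OF X E] by blast
  obtain c' z' where c': "c' @ [z'] \<in> based_chains X E"
    "A = eclass X E c'" "B' = eclass X E (c' @ [z'])"
    using AB' unfolding star_entourage_self[OF X E] by blast
  have "z' = z" using eq c(4) c'(3) by (simp add: endpoint_eclass)
  moreover have "(c @ tl [last c, z], c' @ tl [last c, z]) \<in> ehomotopy X E"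
  proof (rule ehomotopy_concat_left)
    show "(c, c') \<in> ehomotopy X E" using c c' by (simp add: eclass_eq_iff[symmetric])
    have "c \<noteq> []" using c(2) by (auto simp: based_chains_def echain_def)
    with c(1) show "echain X E [last c, z]"
      by (auto simp: based_chains_def echain_append echain_Cons echain_single
          dest: echain_hd_last)
  qed simp
  ultimately show ?thesis using c c' by (simp add: eclass_eq_iff)
qed

text \<open>The set where two lifts agree is closed under passing to close points, in each
  coordinate separately: the images of a neighbour are neighbours of the same class with the
  same endpoint.  Chain connectedness carries the agreement from the basepoint to all points.\<close>

lemma lifts_unique:
  assumes X: "pointed_uniform_space X" and cov: "coverable X" and Y: "pointed_uniform_space Y"
    and h: "h \<in> lifts X Y f" and k: "k \<in> lifts X Y f"
  shows "h = k"
proof (rule extensionalityI)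
  show "h \<in> extensional (points (utilde X))" "k \<in> extensional (points (utilde X))"
    using h k by (simp_all add: lifts_def)
  have hU: "h \<in> points (utilde X) \<rightarrow> points (utilde Y)"
    and kU: "k \<in> points (utilde X) \<rightarrow> points (utilde Y)"
    using h k by (simp_all add: lifts_def ucontinuous_def)
  fix x assume x: "x \<in> points (utilde X)"
  have "h x E = k x E" if E: "E \<in> entourages Y" for E
  proof -
    obtain F1 where F1: "F1 \<in> entourages X"
      "\<And>x y. x \<in> points (utilde X) \<Longrightarrow> y \<in> points (utilde X) \<Longrightarrow>
        (x F1, y F1) \<in> star_entourage X F1 F1 \<Longrightarrow> (h x E, h y E) \<in> star_entourage Y E E"
      using h E unfolding lifts_def ucontinuous_utilde_iff[OF X Y] by blast
    obtain F2 where F2: "F2 \<in> entourages X"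
      "\<And>x y. x \<in> points (utilde X) \<Longrightarrow> y \<in> points (utilde X) \<Longrightarrow>
        (x F2, y F2) \<in> star_entourage X F2 F2 \<Longrightarrow> (k x E, k y E) \<in> star_entourage Y E E"
      using k E unfolding lifts_def ucontinuous_utilde_iff[OF X Y] by blast
    have F: "F1 \<inter> F2 \<in> entourages X" using F1 F2 by (blast intro: entourages_Int)
    show ?thesis
    proof (rule coverable_chain_induct[OF X cov F _ _ x])
      show "h (base (utilde X)) E = k (base (utilde X)) E"
        using h k by (simp add: lifts_def)
    next
      fix x y assume x: "x \<in> points (utilde X)" and y: "y \<in> points (utilde X)"
        and eq: "h x E = k x E"
        and star: "(x (F1 \<inter> F2), y (F1 \<inter> F2)) \<in> star_entourage X (F1 \<inter> F2) (F1 \<inter> F2)"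
      have "(h x E, h y E) \<in> star_entourage Y E E"
        using F1(2)[OF x y] utilde_star_mono[OF x y F1(1) F _ star] by blast
      moreover have "(h x E, k y E) \<in> star_entourage Y E E"
        using F2(2)[OF x y] utilde_star_mono[OF x y F2(1) F _ star] eq by auto
      moreover have "endpoint (h y E) = endpoint (k y E)"
        using endpoint_utilde[OF Y _ E] hU kU h k y
        by (auto simp: lifts_def Pi_iff)
      ultimately show "h y E = k y E"
        by (rule star_entourage_determined[OF Y E])
    qed
  qed
  then show "h x = k x"
    using hU kU x by (intro utilde_eqI[of _ Y]) auto
qed


section \<open>Existence and composition of lifts\<close>

text \<open>The \<open>E\<close>-coordinate of the image is read off at the scale \<open>f\<^sup>-\<^sup>1(E)\<close>, the coarsest one at
  which chains are mapped to \<open>E\<close>-chains; all representatives give the same class, so the union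
  is over equal sets.\<close>

definition ulift ::
    "'a uspace \<Rightarrow> 'b uspace \<Rightarrow> ('a \<Rightarrow> 'b) \<Rightarrow>
      (('a \<times> 'a) set \<Rightarrow> 'a list set) \<Rightarrow> (('b \<times> 'b) set \<Rightarrow> 'b list set)" where
  "ulift X Y f =
     (\<lambda>x\<in>points (utilde X). \<lambda>E\<in>entourages Y. \<Union>c\<in>x (pullback X f E). eclass Y E (map f c))"

locale based_map =
  fixes X :: "'a uspace" and Y :: "'b uspace" and f :: "'a \<Rightarrow> 'b"
  assumes X: "pointed_uniform_space X" and Y: "pointed_uniform_space Y"
    and cont: "ucontinuous X Y f" and based: "f (base X) = base Y"
begin

lemma maps: "f \<in> points X \<rightarrow> points Y"
  using cont by (simp add: ucontinuous_def)

lemma pullback_maps: "F \<subseteq> pullback X f E \<Longrightarrow> map_prod f f ` F \<subseteq> E"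
  by (auto simp: pullback_def)

lemma based_chains_map:
  "c \<in> based_chains X F \<Longrightarrow> map_prod f f ` F \<subseteq> E \<Longrightarrow> map f c \<in> based_chains Y E"
  using echain_map[OF _ maps] based by (auto simp: based_chains_def hd_map echain_def[of X])

text \<open>Any finer scale \<open>F\<close> serves as well, since homotopies at scale \<open>F\<close> are homotopies at scale
  \<open>f\<^sup>-\<^sup>1(E)\<close>.\<close>

lemma ulift_eclass:
  assumes x: "x \<in> points (utilde X)" and E: "E \<in> entourages Y"
    and F: "F \<in> entourages X" "F \<subseteq> pullback X f E" and c: "x F = eclass X F c"
  shows "ulift X Y f x E = eclass Y E (map f c)"
proof -
  let ?P = "pullback X f E"
  have P: "?P \<in> entourages X" by (rule pullback_entourage[OF X cont E])
  have "x ?P = bonding X ?P (x F)" using x F P by (auto simp: utilde_def Let_def)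
  then have xP: "x ?P = eclass X ?P c" by (simp add: c bonding_eclass[OF F(2)])
  have "eclass Y E (map f d) = eclass Y E (map f c)" if "d \<in> eclass X ?P c" for d
    using ehomotopy_map_chain[OF _ maps pullback_maps[OF order_refl]] that
    by (metis eclass_eq_iff mem_eclass)
  moreover have "c \<in> eclass X ?P c" by (simp add: mem_eclass ehomotopy_refl)
  ultimately have "(\<Union>d\<in>eclass X ?P c. eclass Y E (map f d)) = eclass Y E (map f c)" by blast
  then show ?thesis using x E xP by (simp add: ulift_def)
qed

lemma ulift_in_utilde:
  assumes x: "x \<in> points (utilde X)"
  shows "ulift X Y f x \<in> points (utilde Y)"
proof -
  let ?P = "pullback X f"
  have "\<exists>c. c \<in> based_chains X (?P E) \<and>
      (\<forall>F\<in>entourages X. ?P E \<subseteq> F \<longrightarrow> x F = eclass X F c)" if "E \<in> entourages Y" for E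
    using utilde_E[OF x pullback_entourage[OF X cont that]] by metis
  then obtain c where c: "\<And>E. E \<in> entourages Y \<Longrightarrow> c E \<in> based_chains X (?P E)"
    and xc: "\<And>E F. E \<in> entourages Y \<Longrightarrow> F \<in> entourages X \<Longrightarrow> ?P E \<subseteq> F \<Longrightarrow>
      x F = eclass X F (c E)"
    by metis
  have "ulift X Y f x = (\<lambda>E\<in>entourages Y. eclass Y E (map f (c E)))"
  proof (rule extensionalityI)
    show "ulift X Y f x \<in> extensional (entourages Y)" using x by (simp add: ulift_def)
    fix E assume E: "E \<in> entourages Y"
    have P: "?P E \<in> entourages X" by (rule pullback_entourage[OF X cont E])
    show "ulift X Y f x E = (\<lambda>E\<in>entourages Y. eclass Y E (map f (c E))) E"
      using ulift_eclass[OF x E P order_refl] xc[OF E P order_refl] E by simp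
  qed simp
  moreover have "(\<lambda>E\<in>entourages Y. eclass Y E (map f (c E))) \<in> points (utilde Y)"
  proof (rule utilde_I)
    fix E assume "E \<in> entourages Y"
    then show "map f (c E) \<in> based_chains Y E"
      using based_chains_map[OF c pullback_maps] by blast
  next
    fix E F assume E: "E \<in> entourages Y" and F: "F \<in> entourages Y" and "F \<subseteq> E"
    then have "eclass X (?P E) (c F) = eclass X (?P E) (c E)"
      using xc[OF F pullback_entourage[OF X cont E]] xc[OF E pullback_entourage[OF X cont E]]
        pullback_mono by (metis order_refl)
    then show "(map f (c F), map f (c E)) \<in> ehomotopy Y E"
      unfolding eclass_eq_iff by (rule ehomotopy_map_chain[OF _ maps pullback_maps]) simp
  qed
  ultimately show ?thesis by simp
qed

lemma ulift_lifts: "ulift X Y f \<in> lifts X Y f"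
proof -
  have star: "(ulift X Y f x E, ulift X Y f y E) \<in> star_entourage Y E E"
    if E: "E \<in> entourages Y" and x: "x \<in> points (utilde X)" and y: "y \<in> points (utilde X)"
      and xy: "(x (pullback X f E), y (pullback X f E)) \<in>
        star_entourage X (pullback X f E) (pullback X f E)" for E x y
  proof -
    let ?P = "pullback X f E"
    have P: "?P \<in> entourages X" by (rule pullback_entourage[OF X cont E])
    obtain c z where c: "c \<in> based_chains X ?P" "c @ [z] \<in> based_chains X ?P"
      "x ?P = eclass X ?P c" "y ?P = eclass X ?P (c @ [z])"
      using xy unfolding star_entourage_self[OF X P] by blast
    have "map f c \<in> based_chains Y E" "map f c @ [f z] \<in> based_chains Y E"
      using based_chains_map[OF c(1) pullback_maps[OF order_refl]]
        based_chains_map[OF c(2) pullback_maps[OF order_refl]] by simp_all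
    moreover have "ulift X Y f x E = eclass Y E (map f c)"
      "ulift X Y f y E = eclass Y E (map f c @ [f z])"
      using ulift_eclass[OF x E P order_refl c(3)] ulift_eclass[OF y E P order_refl c(4)]
      by simp_all
    ultimately show ?thesis unfolding star_entourage_self[OF Y E] by blast
  qed
  have "ucontinuous (utilde X) (utilde Y) (ulift X Y f)"
    unfolding ucontinuous_utilde_iff[OF X Y]
    using star pullback_entourage[OF X cont] ulift_in_utilde by blast
  moreover have "ulift X Y f (base (utilde X)) = base (utilde Y)"
  proof (rule utilde_eqI)
    fix E assume E: "E \<in> entourages Y"
    have P: "pullback X f E \<in> entourages X" by (rule pullback_entourage[OF X cont E])
    show "ulift X Y f (base (utilde X)) E = base (utilde Y) E"
      using ulift_eclass[OF base_in_utilde[OF X] E P order_refl base_utilde[OF P]]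
      by (simp add: base_utilde[OF E] based)
  qed (use base_in_utilde[OF X] base_in_utilde[OF Y] ulift_in_utilde in auto)
  moreover have "f (uproj X x) = uproj Y (ulift X Y f x)" if x: "x \<in> points (utilde X)" for x
  proof -
    have Y2: "points Y \<times> points Y \<in> entourages Y" by (rule total_entourage[OF Y])
    let ?P = "pullback X f (points Y \<times> points Y)"
    have P: "?P \<in> entourages X" by (rule pullback_entourage[OF X cont Y2])
    obtain c where c: "c \<in> based_chains X ?P" "x ?P = eclass X ?P c"
      using utilde_E[OF x P] P by (metis order_refl)
    have "c \<noteq> []" using c(1) by (auto simp: based_chains_def echain_def)
    then show ?thesis
      using ulift_eclass[OF x Y2 P order_refl c(2)] endpoint_utilde[OF X x P]
        endpoint_utilde[OF Y ulift_in_utilde[OF x] Y2] c(2)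
      by (simp add: endpoint_eclass last_map)
  qed
  ultimately show ?thesis by (simp add: lifts_def ulift_def)
qed

lemma ex1_lifts: "coverable X \<Longrightarrow> \<exists>!h. h \<in> lifts X Y f"
  using ulift_lifts lifts_unique[OF X _ Y] by blast

lemma lift_eqI: "coverable X \<Longrightarrow> h \<in> lifts X Y f \<Longrightarrow> lift X Y f = h"
  unfolding lift_def using lifts_unique[OF X _ Y] by blast

lemma lift_eq_ulift: "coverable X \<Longrightarrow> lift X Y f = ulift X Y f"
  by (rule lift_eqI[OF _ ulift_lifts])

end

lemma compose_lifts:
  assumes f: "h \<in> lifts X Y f" and g: "k \<in> lifts Y Z g"
    and X: "pointed_uniform_space X"
  shows "compose (points (utilde X)) k h \<in> lifts X Z (g \<circ> f)"
proof -
  let ?h = "compose (points (utilde X)) k h"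
  have hU: "h \<in> points (utilde X) \<rightarrow> points (utilde Y)"
    and kU: "k \<in> points (utilde Y) \<rightarrow> points (utilde Z)"
    using f g by (simp_all add: lifts_def ucontinuous_def)
  have lims: "filterlim (map_prod h h) (unif (utilde Y)) (unif (utilde X))"
    "filterlim (map_prod k k) (unif (utilde Z)) (unif (utilde Y))"
    using f g by (simp_all add: lifts_def ucontinuous_def)
  have onU: "eventually (\<lambda>p. p \<in> points (utilde X) \<times> points (utilde X)) (unif (utilde X))"
    using total_entourage[OF X] by (auto simp: eventually_utilde[OF X])
  have "filterlim (\<lambda>p. map_prod k k (map_prod h h p)) (unif (utilde Z)) (unif (utilde X))"
    by (rule filterlim_compose[OF lims(2,1)])
  moreover have "eventually (\<lambda>p. map_prod k k (map_prod h h p) = map_prod ?h ?h p)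
      (unif (utilde X))"
    using onU by eventually_elim (auto simp: compose_def)
  ultimately have "filterlim (map_prod ?h ?h) (unif (utilde Z)) (unif (utilde X))"
    using filterlim_cong[OF refl refl] by fastforce
  then show ?thesis
    using hU kU f g base_in_utilde[OF X]
    by (auto simp: lifts_def ucontinuous_def compose_eq Pi_iff compose_extensional)
qed

section \<open>The deck group acts\<close>

lemma delta1_iff:
  assumes "pointed_uniform_space X"
  shows "g \<in> carrier (delta1 X) \<longleftrightarrow> g \<in> points (utilde X) \<and> uproj X g = base X"
  using delta1_eq_fibre[OF total_entourage[OF assms]] by auto

lemma delta1_mult: "g \<otimes>\<^bsub>delta1 X\<^esub> h = delta1_action X g h"
  by (simp add: delta1_def product_group_def deck_group_def delta1_action_def)

lemma delta1_action_eclass: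
  assumes X: "pointed_uniform_space X"
    and g: "g \<in> carrier (delta1 X)" and x: "x \<in> points (utilde X)" and E: "E \<in> entourages X"
    and l: "l \<in> based_chains X E" "g E = eclass X E l"
    and c: "c \<in> based_chains X E" "x E = eclass X E c"
  shows "delta1_action X g x E = eclass X E (l @ tl c)"
    and "l @ tl c \<in> based_chains X E" and "last (l @ tl c) = last c"
proof -
  have "last l = base X"
    using endpoint_utilde[OF X _ E, of g] g l(2)
    by (simp add: delta1_iff[OF X] endpoint_eclass)
  with l c have lc: "echain X E l" "echain X E c" "last l = hd c" and ne: "l \<noteq> []" "c \<noteq> []"
    by (auto simp: based_chains_def echain_def)
  show "delta1_action X g x E = eclass X E (l @ tl c)"
    using E l c econcat_eclass[OF lc] by (simp add: delta1_action_def)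
  show "l @ tl c \<in> based_chains X E"
    using echain_concat[OF lc] l(1) ne by (simp add: based_chains_def)
  show "last (l @ tl c) = last c" by (rule last_concat[OF ne lc(3)])
qed

lemma delta1_action_in_utilde:
  assumes X: "pointed_uniform_space X"
    and g: "g \<in> carrier (delta1 X)" and x: "x \<in> points (utilde X)"
  shows "delta1_action X g x \<in> points (utilde X)"
proof -
  have gU: "g \<in> points (utilde X)" using g by (simp add: delta1_iff[OF X])
  obtain l where l: "\<And>F. F \<in> entourages X \<Longrightarrow> l F \<in> based_chains X F"
    "\<And>F E. F \<in> entourages X \<Longrightarrow> E \<in> entourages X \<Longrightarrow> F \<subseteq> E \<Longrightarrow> g E = eclass X E (l F)"
    by (rule utilde_representatives[OF gU]) blast
  obtain c where c: "\<And>F. F \<in> entourages X \<Longrightarrow> c F \<in> based_chains X F"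
    "\<And>F E. F \<in> entourages X \<Longrightarrow> E \<in> entourages X \<Longrightarrow> F \<subseteq> E \<Longrightarrow> x E = eclass X E (c F)"
    by (rule utilde_representatives[OF x]) blast
  have act: "delta1_action X g x E = eclass X E (l F @ tl (c F))"
    "l E @ tl (c E) \<in> based_chains X E"
    if E: "E \<in> entourages X" and F: "F \<in> entourages X" and FE: "F \<subseteq> E" for E F
  proof -
    have "l F \<in> based_chains X E" "c F \<in> based_chains X E"
      using l(1)[OF F] c(1)[OF F] based_chains_mono[OF FE, of X] by auto
    then show "delta1_action X g x E = eclass X E (l F @ tl (c F))"
      by (intro delta1_action_eclass(1)[OF X g x E _ l(2)[OF F E FE] _ c(2)[OF F E FE]])
    show "l E @ tl (c E) \<in> based_chains X E"
      by (rule delta1_action_eclass(2)[OF X g x E l(1)[OF E] l(2)[OF E E order_refl]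
            c(1)[OF E] c(2)[OF E E order_refl]])
  qed
  have "delta1_action X g x = (\<lambda>E\<in>entourages X. eclass X E (l E @ tl (c E)))"
    using act(1)[OF _ _ order_refl]
    by (intro extensionalityI[of _ "entourages X"]) (auto simp: delta1_action_def)
  moreover have "(\<lambda>E\<in>entourages X. eclass X E (l E @ tl (c E))) \<in> points (utilde X)"
  proof (rule utilde_I)
    fix E F assume "E \<in> entourages X" "F \<in> entourages X" "F \<subseteq> E"
    then show "(l F @ tl (c F), l E @ tl (c E)) \<in> ehomotopy X E"
      unfolding eclass_eq_iff[symmetric] using act(1) by (metis order_refl)
  qed (use act(2) in blast)
  ultimately show ?thesis by simp
qed

lemma uproj_delta1_action:
  assumes X: "pointed_uniform_space X"
    and g: "g \<in> carrier (delta1 X)" and x: "x \<in> points (utilde X)"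
  shows "uproj X (delta1_action X g x) = uproj X x"
proof -
  let ?T = "points X \<times> points X"
  have T: "?T \<in> entourages X" by (rule total_entourage[OF X])
  have gU: "g \<in> points (utilde X)" using g by (simp add: delta1_iff[OF X])
  obtain l where l: "l \<in> based_chains X ?T" "g ?T = eclass X ?T l"
    using utilde_E[OF gU T] T by (metis order_refl)
  obtain c where c: "c \<in> based_chains X ?T" "x ?T = eclass X ?T c"
    using utilde_E[OF x T] T by (metis order_refl)
  show ?thesis
    using delta1_action_eclass[OF X g x T l c] c(2) by (simp add: uproj_def endpoint_eclass)
qed

context based_map
begin

lemma ulift_delta1:
  "g \<in> carrier (delta1 X) \<Longrightarrow> ulift X Y f g \<in> carrier (delta1 Y)"
  using ulift_lifts ulift_in_utilde based
  by (auto simp: delta1_iff[OF X] delta1_iff[OF Y] lifts_def)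

text \<open>Concatenation of chains is preserved by mapping them, and this is all that
  equivariance expresses in each coordinate.\<close>

lemma ulift_equivariant:
  assumes g: "g \<in> carrier (delta1 X)" and x: "x \<in> points (utilde X)"
  shows "ulift X Y f (delta1_action X g x) = delta1_action Y (ulift X Y f g) (ulift X Y f x)"
proof (rule utilde_eqI)
  have gU: "g \<in> points (utilde X)" using g by (simp add: delta1_iff[OF X])
  have gx: "delta1_action X g x \<in> points (utilde X)"
    by (rule delta1_action_in_utilde[OF X g x])
  show "ulift X Y f (delta1_action X g x) \<in> points (utilde Y)"
    by (rule ulift_in_utilde[OF gx])
  show "delta1_action Y (ulift X Y f g) (ulift X Y f x) \<in> points (utilde Y)"
    by (rule delta1_action_in_utilde[OF Y ulift_delta1[OF g] ulift_in_utilde[OF x]])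
  fix E assume E: "E \<in> entourages Y"
  let ?P = "pullback X f E"
  have P: "?P \<in> entourages X" by (rule pullback_entourage[OF X cont E])
  obtain l where l: "l \<in> based_chains X ?P" "g ?P = eclass X ?P l"
    using utilde_E[OF gU P] P by (metis order_refl)
  obtain c where c: "c \<in> based_chains X ?P" "x ?P = eclass X ?P c"
    using utilde_E[OF x P] P by (metis order_refl)
  have "ulift X Y f (delta1_action X g x) E = eclass Y E (map f l @ tl (map f c))"
    using ulift_eclass[OF gx E P order_refl delta1_action_eclass(1)[OF X g x P l c]]
    by (simp add: map_tl)
  also have "\<dots> = delta1_action Y (ulift X Y f g) (ulift X Y f x) E"
    using delta1_action_eclass(1)[OF Y ulift_delta1[OF g] ulift_in_utilde[OF x] E
        based_chains_map[OF l(1) pullback_maps[OF order_refl]]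
        ulift_eclass[OF gU E P order_refl l(2)]
        based_chains_map[OF c(1) pullback_maps[OF order_refl]]
        ulift_eclass[OF x E P order_refl c(2)]]
    by simp
  finally show "ulift X Y f (delta1_action X g x) E =
      delta1_action Y (ulift X Y f g) (ulift X Y f x) E" .
qed

lemma lift_star_hom:
  assumes "coverable X"
  shows "lift_star X Y f \<in> hom (delta1 X) (delta1 Y)"
proof (rule homI)
  fix g assume "g \<in> carrier (delta1 X)"
  then show "lift_star X Y f g \<in> carrier (delta1 Y)"
    by (simp add: lift_star_def lift_eq_ulift[OF assms] ulift_delta1)
next
  fix g h assume g: "g \<in> carrier (delta1 X)" and h: "h \<in> carrier (delta1 X)"
  then have hU: "h \<in> points (utilde X)" by (simp add: delta1_iff[OF X])
  have "delta1_action X g h \<in> carrier (delta1 X)"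
    using delta1_action_in_utilde[OF X g hU] uproj_delta1_action[OF X g hU] h
    by (simp add: delta1_iff[OF X])
  then show "lift_star X Y f (g \<otimes>\<^bsub>delta1 X\<^esub> h) =
      lift_star X Y f g \<otimes>\<^bsub>delta1 Y\<^esub> lift_star X Y f h"
    using g h ulift_equivariant[OF g hU]
    by (simp add: lift_star_def lift_eq_ulift[OF assms] delta1_mult)
qed

end


section \<open>Unique lifting of chains and homotopies\<close>

text \<open>A covering map at one scale: steps lift, and the fibres are separated.  There are three
  factors \<open>E\<close> because a lifted step and a lifted detour of two steps with the same start must
  have the same end.\<close>

definition lifting_entourage :: "'a uspace \<Rightarrow> 'b uspace \<Rightarrow> ('a \<Rightarrow> 'b) \<Rightarrow> ('a \<times> 'a) set \<Rightarrow> bool" where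
  "lifting_entourage X Y f E \<longleftrightarrow>
     E \<in> entourages X \<and> map_prod f f ` E \<in> entourages Y \<and>
     (\<forall>x\<in>points X. \<forall>y. (f x, y) \<in> map_prod f f ` E \<longrightarrow> (\<exists>b. (x, b) \<in> E \<and> f b = y)) \<and>
     (\<forall>a b. (a, b) \<in> E O E O E \<longrightarrow> f a = f b \<longrightarrow> a = b)"

context based_map
begin

context
  fixes E assumes lifting: "lifting_entourage X Y f E"
begin

lemma lifting_ent: "E \<in> entourages X"
  using lifting by (simp add: lifting_entourage_def)

lemma lifting_image_ent: "map_prod f f ` E \<in> entourages Y"
  using lifting by (simp add: lifting_entourage_def)

lemma lifting_step: "x \<in> points X \<Longrightarrow> (f x, y) \<in> map_prod f f ` E \<Longrightarrow> \<exists>b. (x, b) \<in> E \<and> f b = y"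
  using lifting[unfolded lifting_entourage_def, THEN conjunct2, THEN conjunct2, THEN conjunct1]
  by simp

lemma lifting_separates3:
  "(a, x) \<in> E \<Longrightarrow> (x, y) \<in> E \<Longrightarrow> (y, b) \<in> E \<Longrightarrow> f a = f b \<Longrightarrow> a = b"
  using lifting unfolding lifting_entourage_def by blast

lemma lifting_separates1: "(a, b) \<in> E \<Longrightarrow> f a = f b \<Longrightarrow> a = b"
  using lifting_separates3[of a b a b] entourage_sym[OF lifting_ent] by blast

lemma lifting_separates2: "(a, x) \<in> E \<Longrightarrow> (x, b) \<in> E \<Longrightarrow> f a = f b \<Longrightarrow> a = b"
  using lifting_separates3[of a x b b] entourage_subset[OF lifting_ent]
    entourage_refl[OF X lifting_ent] by blast

lemma lifting_step_unique: "(x, b) \<in> E \<Longrightarrow> (x, b') \<in> E \<Longrightarrow> f b = f b' \<Longrightarrow> b = b'"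
  using lifting_separates2[of b x b'] entourage_sym[OF lifting_ent] by blast

lemma chain_lift_ex:
  assumes "x \<in> points X" "echain Y (map_prod f f ` E) (f x # d)"
  shows "\<exists>c. echain X E (x # c) \<and> map f c = d"
  using assms
proof (induction d arbitrary: x)
  case Nil
  then show ?case by (simp add: echain_single)
next
  case (Cons y d)
  then have "(f x, y) \<in> map_prod f f ` E" and chain: "echain Y (map_prod f f ` E) (y # d)"
    by (simp_all add: echain_Cons)
  from lifting_step[OF Cons.prems(1) this(1)] obtain b where b: "(x, b) \<in> E" "f b = y"
    by (elim exE conjE)
  then have "b \<in> points X" using entourage_subset[OF lifting_ent] by blast
  with Cons.IH[of b] chain b obtain c where "echain X E (b # c)" "map f c = d" by auto
  with b Cons.prems have "echain X E (x # b # c)" "map f (b # c) = y # d"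
    by (simp_all add: echain_Cons)
  then show ?case by (intro exI[of _ "b # c"] conjI)
qed

lemma chain_lift_unique:
  assumes "echain X E c" "echain X E c'" "hd c = hd c'" "map f c = map f c'"
  shows "c = c'"
  using assms
proof (induction c arbitrary: c')
  case Nil
  then show ?case by (simp add: echain_def)
next
  case (Cons x d)
  then obtain d' where c': "c' = x # d'" "map f d = map f d'"
    by (cases c') (auto simp: echain_def)
  show ?case
  proof (cases "d = []")
    case True
    with c' show ?thesis by simp
  next
    case False
    with c'(2) have d': "d' \<noteq> []" by auto
    have chains: "echain X E d" "(x, hd d) \<in> E" "echain X E d'" "(x, hd d') \<in> E"
      using Cons.prems False d' c' by (simp_all add: echain_Cons)
    have "f (hd d) = f (hd d')" using c'(2) False d' by (metis hd_map)
    then have "hd d = hd d'" using lifting_step_unique chains by blast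
    with Cons.IH chains c' show ?thesis by blast
  qed
qed

lemma based_chain_lift:
  assumes "d \<in> based_chains Y (map_prod f f ` E)"
  shows "\<exists>!c. c \<in> based_chains X E \<and> map f c = d"
proof (rule ex_ex1I)
  from assms obtain e where e: "d = f (base X) # e"
    by (cases d) (auto simp: based_chains_def echain_def based)
  moreover have "base X \<in> points X" using X by (simp add: pointed_uniform_space_def)
  ultimately obtain c where "echain X E (base X # c)" "map f c = e"
    using chain_lift_ex assms by (auto simp: based_chains_def)
  with e show "\<exists>c. c \<in> based_chains X E \<and> map f c = d"
    by (intro exI[of _ "base X # c"]) (simp add: based_chains_def)
next
  fix c c' assume "c \<in> based_chains X E \<and> map f c = d" "c' \<in> based_chains X E \<and> map f c' = d"
  then show "c = c'" by (intro chain_lift_unique) (auto simp: based_chains_def)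
qed

text \<open>When a point is inserted between two neighbours, the lifts of the old and the new chain
  agree up to the inserted point.  Behind it, they continue at points over the same point of
  \<open>Y\<close> that are three steps apart, hence equal.\<close>

lemma insertion_lift:
  assumes ins: "(map f c, map f c') \<in> insertion Y (map_prod f f ` E)"
    and c: "c \<in> based_chains X E" and c': "c' \<in> based_chains X E"
  shows "(c, c') \<in> insertion X E"
proof -
  from ins obtain us y vs where "map f c = us @ vs" "map f c' = us @ y # vs"
    and hds: "hd (map f c) = hd (map f c')" and lasts: "last (map f c) = last (map f c')"
    by (rule insertionE)
  then obtain u v u' x v' where eq: "c = u @ v" "c' = u' @ x # v'"
    and fu: "map f u = map f u'" and fv: "map f v = map f v'"
    by (auto simp: map_eq_append_conv map_eq_Cons_conv)
  have ch: "echain X E c" "echain X E c'" "hd c = hd c'"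
    using c c' by (auto simp: based_chains_def)
  have "u = u' \<and> v = v' \<and> last c = last c'"
  proof (cases "u = []")
    case True
    with fu have "u' = []" by simp
    have v: "v \<noteq> []" using ch(1) eq True by (auto simp: echain_def)
    with fv have v': "v' \<noteq> []" by auto
    have xv: "(x, hd v') \<in> E" "echain X E v'" "hd v = x"
      using ch v' eq True \<open>u' = []\<close> by (simp_all add: echain_Cons)
    moreover have "f (hd v') = f (hd v)" using fv v v' by (metis hd_map)
    ultimately have "hd v' = hd v" using lifting_separates1 by metis
    then have "v = v'" using chain_lift_unique ch(1) eq True xv(2) fv by auto
    with True \<open>u' = []\<close> v eq show ?thesis by simp
  next
    case False
    with fu have u': "u' \<noteq> []" by auto
    have pre: "echain X E u" "echain X E u'" "(last u', x) \<in> E" "echain X E (x # v')"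
      using ch eq False u' by (cases "v = []"; simp add: echain_append)+
    have "hd u = hd u'" using ch(3) eq False u' by simp
    then have u: "u = u'" using chain_lift_unique pre fu by blast
    show ?thesis
    proof (cases "v = []")
      case True
      with fv have v': "v' = []" by simp
      have "f (last u') = f x" using lasts eq True v' u u' by (simp add: last_map)
      then have "last u' = x" using lifting_separates1 pre(3) by blast
      with u True v' eq show ?thesis by simp
    next
      case v: False
      with fv have v': "v' \<noteq> []" by auto
      have steps: "(last u', hd v) \<in> E" "echain X E v" "(x, hd v') \<in> E" "echain X E v'"
        using ch(1) pre(4) eq u u' v v' by (simp_all add: echain_append echain_Cons)
      have "f (hd v) = f (hd v')" using fv v v' by (metis hd_map)
      then have "hd v = hd v'"
        using lifting_separates3 entourage_sym[OF lifting_ent steps(1)] pre(3) steps(3) by blast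
      then have "v = v'" using chain_lift_unique steps fv by blast
      with u v eq show ?thesis by simp
    qed
  qed
  then show ?thesis using ch eq by (intro insertionI[where us = u and x = x and vs = v]) auto
qed

text \<open>Unique lifting defines a map from chains in \<open>Y\<close> to chains in \<open>X\<close>, and it respects
  homotopies since it respects insertions.\<close>

lemma ehomotopy_lift:
  assumes hom: "(map f c, map f c') \<in> ehomotopy Y (map_prod f f ` E)"
    and c: "c \<in> based_chains X E" and c': "c' \<in> based_chains X E"
  shows "(c, c') \<in> ehomotopy X E"
proof -
  define L where "L = (\<lambda>d. THE c. c \<in> based_chains X E \<and> map f c = d)"
  have L: "L d \<in> based_chains X E" "map f (L d) = d"
    if "d \<in> based_chains Y (map_prod f f ` E)" for d
    using theI'[OF based_chain_lift[OF that]] by (simp_all add: L_def)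
  have Lmap: "L (map f c) = c" if "c \<in> based_chains X E" for c
    using based_chain_lift[OF based_chains_map[OF that order_refl]] L[of "map f c"]
      based_chains_map[OF that order_refl] that by blast
  have "(L (map f c), L (map f c')) \<in> ehomotopy X E"
  proof (rule ehomotopy_map[OF hom])
    fix a b assume ab: "(a, b) \<in> insertion Y (map_prod f f ` E)" and "hd a = hd (map f c)"
    then have "a \<in> based_chains Y (map_prod f f ` E)" "b \<in> based_chains Y (map_prod f f ` E)"
      using based_chains_map[OF c order_refl]
      by (auto simp: based_chains_def insertion_def)
    with ab show "(L a, L b) \<in> ehomotopy X E"
      using insertion_lift[of "L a" "L b"] L by (auto intro: insertion_ehomotopy)
  qed
  then show ?thesis using Lmap c c' by simp
qed

text \<open>Neighbours in the chain space of \<open>Y\<close> have representatives that differ by one step.  Lifting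
  the longer one lifts both, and by \<open>ehomotopy_lift\<close> the lifts represent the given classes.\<close>

lemma star_entourage_lift:
  assumes star: "(eclass Y (map_prod f f ` E) (map f c), eclass Y (map_prod f f ` E) (map f c'))
      \<in> star_entourage Y (map_prod f f ` E) (map_prod f f ` E)"
    and c: "c \<in> based_chains X E" and c': "c' \<in> based_chains X E"
  shows "(eclass X E c, eclass X E c') \<in> star_entourage X E E"
proof -
  let ?E = "map_prod f f ` E"
  obtain d z where d: "d \<in> based_chains Y ?E" "d @ [z] \<in> based_chains Y ?E"
    "eclass Y ?E (map f c) = eclass Y ?E d" "eclass Y ?E (map f c') = eclass Y ?E (d @ [z])"
    using star unfolding star_entourage_self[OF Y lifting_image_ent] by blast
  obtain e where e: "e \<in> based_chains X E" "map f e = d @ [z]"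
    using based_chain_lift[OF d(2)] by blast
  from e(2) obtain b w where bw: "e = b @ [w]" "map f b = d" "f w = z"
    by (auto simp: map_eq_append_conv)
  have "b \<noteq> []" using bw(2) d(1) by (auto simp: based_chains_def echain_def)
  then have b: "b \<in> based_chains X E"
    using e(1) bw(1) by (auto simp: based_chains_def echain_append)
  have "eclass X E c = eclass X E b" "eclass X E c' = eclass X E (b @ [w])"
    unfolding eclass_eq_iff
    using ehomotopy_lift[OF _ c b] ehomotopy_lift[OF _ c' e(1)[unfolded bw(1)]]
      d(3,4)[unfolded eclass_eq_iff] bw by simp_all
  then show ?thesis
    unfolding star_entourage_self[OF X lifting_ent] using b e(1) bw(1) by blast
qed

lemma ulift_image_eclass:
  assumes "x \<in> points (utilde X)" "x E = eclass X E c"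
  shows "ulift X Y f x (map_prod f f ` E) = eclass Y (map_prod f f ` E) (map f c)"
proof -
  have "E \<subseteq> pullback X f (map_prod f f ` E)"
    using entourage_subset[OF lifting_ent] by (force simp: pullback_def)
  then show ?thesis
    using ulift_eclass[OF assms(1) lifting_image_ent lifting_ent] assms(2) by blast
qed

end

end

section \<open>Chain-lifting maps induce homeomorphisms of the inverse limits\<close>

context based_map
begin

context
  assumes cofinal: "\<And>E. E \<in> entourages X \<Longrightarrow> \<exists>F. F \<subseteq> E \<and> lifting_entourage X Y f F"
begin

text \<open>The coordinates of a point \<open>y\<close> lift consistently: both chains are compared with a lift at
  a common finer scale.  With two representatives for one scale this gives injectivity of the
  lift of \<open>f\<close>, with different scales the compatibility of a preimage of \<open>y\<close>.\<close>

lemma lifted_coordinates_agree: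
  assumes y: "y \<in> points (utilde Y)" and E: "E \<in> entourages X"
    and F: "lifting_entourage X Y f F" "F \<subseteq> E"
    and F': "lifting_entourage X Y f F'" "F' \<subseteq> E"
    and c: "c \<in> based_chains X F" "y (map_prod f f ` F) = eclass Y (map_prod f f ` F) (map f c)"
    and c': "c' \<in> based_chains X F'"
      "y (map_prod f f ` F') = eclass Y (map_prod f f ` F') (map f c')"
  shows "eclass X E c = eclass X E c'"
proof -
  obtain D where D: "D \<subseteq> F \<inter> F'" "lifting_entourage X Y f D"
    using cofinal entourages_Int lifting_ent F(1) F'(1) by meson
  obtain d where d: "d \<in> based_chains Y (map_prod f f ` D)"
    "\<And>E. E \<in> entourages Y \<Longrightarrow> map_prod f f ` D \<subseteq> E \<Longrightarrow> y E = eclass Y E d"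
    using utilde_E[OF y lifting_image_ent[OF D(2)]] by metis
  obtain b where b: "b \<in> based_chains X D" "map f b = d"
    using based_chain_lift[OF D(2) d(1)] by blast
  have agree: "eclass X E a = eclass X E b"
    if H: "lifting_entourage X Y f H" "H \<subseteq> E" "D \<subseteq> H" and a: "a \<in> based_chains X H"
      and ya: "y (map_prod f f ` H) = eclass Y (map_prod f f ` H) (map f a)" for H a
  proof -
    have "y (map_prod f f ` H) = eclass Y (map_prod f f ` H) (map f b)"
      using d(2)[OF lifting_image_ent[OF H(1)] image_mono[OF H(3)]] b(2) by simp
    then have "(map f a, map f b) \<in> ehomotopy Y (map_prod f f ` H)"
      using ya by (simp add: eclass_eq_iff)
    then have "(a, b) \<in> ehomotopy X H"
      using ehomotopy_lift[OF H(1) _ a] b(1) based_chains_mono[OF H(3), of X] by blast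
    then show ?thesis
      using ehomotopy_mono[OF H(2), of X] by (auto simp: eclass_eq_iff)
  qed
  show ?thesis using agree[OF F _ c] agree[OF F' _ c'] D(1) by simp
qed

lemma ulift_inj: "inj_on (ulift X Y f) (points (utilde X))"
proof (rule inj_onI)
  fix x x' assume x: "x \<in> points (utilde X)" and x': "x' \<in> points (utilde X)"
    and eq: "ulift X Y f x = ulift X Y f x'"
  show "x = x'"
  proof (rule utilde_eqI[OF x x'])
    fix E assume E: "E \<in> entourages X"
    obtain F where F: "F \<subseteq> E" "lifting_entourage X Y f F" using cofinal[OF E] by blast
    have Fe: "F \<in> entourages X" by (rule lifting_ent[OF F(2)])
    obtain c where c: "c \<in> based_chains X F" "x F = eclass X F c" "x E = eclass X E c"
      using utilde_E[OF x Fe] E F(1) Fe by (metis order_refl)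
    obtain c' where c': "c' \<in> based_chains X F" "x' F = eclass X F c'" "x' E = eclass X E c'"
      using utilde_E[OF x' Fe] E F(1) Fe by (metis order_refl)
    have "eclass X E c = eclass X E c'"
      using lifted_coordinates_agree[OF ulift_in_utilde[OF x] E F(2,1) F(2,1) c(1)
          ulift_image_eclass[OF F(2) x c(2)] c'(1)]
        ulift_image_eclass[OF F(2) x' c'(2)] eq by simp
    then show "x E = x' E" using c(3) c'(3) by simp
  qed
qed

lemma ulift_surj:
  assumes y: "y \<in> points (utilde Y)"
  shows "\<exists>x\<in>points (utilde X). ulift X Y f x = y"
proof -
  have "\<exists>F. F \<subseteq> E \<and> lifting_entourage X Y f F" if "E \<in> entourages X" for E
    by (rule cofinal[OF that])
  then obtain \<phi> where \<phi>: "\<And>E. E \<in> entourages X \<Longrightarrow> \<phi> E \<subseteq> E"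
    "\<And>E. E \<in> entourages X \<Longrightarrow> lifting_entourage X Y f (\<phi> E)"
    by metis
  have lifted: "\<exists>c. c \<in> based_chains X F \<and>
      y (map_prod f f ` F) = eclass Y (map_prod f f ` F) (map f c)"
    if F: "lifting_entourage X Y f F" for F
  proof -
    obtain d where d: "d \<in> based_chains Y (map_prod f f ` F)"
      "y (map_prod f f ` F) = eclass Y (map_prod f f ` F) d"
      using utilde_E[OF y lifting_image_ent[OF F]] lifting_image_ent[OF F] by (metis order_refl)
    show ?thesis using based_chain_lift[OF F d(1)] d(2) by blast
  qed
  then obtain c where c: "\<And>F. lifting_entourage X Y f F \<Longrightarrow> c F \<in> based_chains X F"
    "\<And>F. lifting_entourage X Y f F \<Longrightarrow>
      y (map_prod f f ` F) = eclass Y (map_prod f f ` F) (map f (c F))"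
    by metis
  have agree: "eclass X E (c F) = eclass X E (c F')"
    if "E \<in> entourages X" "lifting_entourage X Y f F" "F \<subseteq> E" "lifting_entourage X Y f F'" "F' \<subseteq> E"
    for E F F'
    using lifted_coordinates_agree[OF y that c(1)[OF that(2)] c(2)[OF that(2)]
        c(1)[OF that(4)] c(2)[OF that(4)]] .
  define x where "x = (\<lambda>E\<in>entourages X. eclass X E (c (\<phi> E)))"
  have x: "x \<in> points (utilde X)"
    unfolding x_def
  proof (rule utilde_I)
    fix E assume E: "E \<in> entourages X"
    show "c (\<phi> E) \<in> based_chains X E"
      using c(1)[OF \<phi>(2)[OF E]] based_chains_mono[OF \<phi>(1)[OF E], of X] by blast
  next
    fix E F assume E: "E \<in> entourages X" and F: "F \<in> entourages X" and "F \<subseteq> E"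
    then show "(c (\<phi> F), c (\<phi> E)) \<in> ehomotopy X E"
      using agree[OF E \<phi>(2)[OF F] _ \<phi>(2)[OF E] \<phi>(1)[OF E]] \<phi>(1)[OF F]
      by (auto simp: eclass_eq_iff)
  qed
  have "ulift X Y f x = y"
  proof (rule utilde_eqI[OF ulift_in_utilde[OF x] y])
    \<comment> \<open>The \<open>E\<close>-coordinate is determined by the coordinate at the finer scale \<open>f(F)\<close>, where the
      equality holds by the choice of \<open>c\<close>.\<close>
    fix E assume E: "E \<in> entourages Y"
    let ?P = "pullback X f E"
    have P: "?P \<in> entourages X" by (rule pullback_entourage[OF X cont E])
    let ?F = "\<phi> ?P"
    have F: "lifting_entourage X Y f ?F" "?F \<subseteq> ?P" using \<phi> P by auto
    have "x ?P = eclass X ?P (c ?F)" using P by (simp add: x_def)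
    then have "ulift X Y f x E = eclass Y E (map f (c ?F))"
      by (rule ulift_eclass[OF x E P order_refl])
    also have "\<dots> = bonding Y E (y (map_prod f f ` ?F))"
      using c(2)[OF F(1)] bonding_eclass[OF pullback_maps[OF F(2)]] by metis
    also have "\<dots> = y E"
      using y E lifting_image_ent[OF F(1)] pullback_maps[OF F(2)]
      by (auto simp: utilde_def Let_def)
    finally show "ulift X Y f x E = y E" .
  qed
  with x show ?thesis by blast
qed

text \<open>For continuity of the inverse at the scale \<open>E\<close> choose a lifting entourage \<open>F \<subseteq> E\<close>: closeness
  at the scale \<open>f(F)\<close> lifts to closeness at the scale \<open>F\<close>.\<close>

lemma ulift_uhomeomorphism: "uhomeomorphism (utilde X) (utilde Y) (ulift X Y f)"
proof -
  have bij: "bij_betw (ulift X Y f) (points (utilde X)) (points (utilde Y))"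
    unfolding bij_betw_def using ulift_inj ulift_surj ulift_in_utilde by blast
  let ?g = "inv_into (points (utilde X)) (ulift X Y f)"
  have g: "?g y \<in> points (utilde X)" "ulift X Y f (?g y) = y" if "y \<in> points (utilde Y)" for y
    using bij that by (auto simp: bij_betw_def f_inv_into_f intro: inv_into_into)
  have "\<exists>F\<in>entourages Y. \<forall>y\<in>points (utilde Y). \<forall>y'\<in>points (utilde Y).
      (y F, y' F) \<in> star_entourage Y F F \<longrightarrow> (?g y E, ?g y' E) \<in> star_entourage X E E"
    if E: "E \<in> entourages X" for E
  proof -
    obtain F where F: "F \<subseteq> E" "lifting_entourage X Y f F" using cofinal[OF E] by blast
    have Fe: "F \<in> entourages X" by (rule lifting_ent[OF F(2)])
    let ?F = "map_prod f f ` F"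
    have "(?g y E, ?g y' E) \<in> star_entourage X E E"
      if y: "y \<in> points (utilde Y)" and y': "y' \<in> points (utilde Y)"
        and star: "(y ?F, y' ?F) \<in> star_entourage Y ?F ?F" for y y'
    proof -
      obtain c where c: "c \<in> based_chains X F" "?g y F = eclass X F c"
        using utilde_E[OF g(1)[OF y] Fe] Fe by (metis order_refl)
      obtain c' where c': "c' \<in> based_chains X F" "?g y' F = eclass X F c'"
        using utilde_E[OF g(1)[OF y'] Fe] Fe by (metis order_refl)
      have "y ?F = eclass Y ?F (map f c)" "y' ?F = eclass Y ?F (map f c')"
        using ulift_image_eclass[OF F(2) g(1)[OF y] c(2)]
          ulift_image_eclass[OF F(2) g(1)[OF y'] c'(2)] g(2) y y' by simp_all
      with star have "(?g y F, ?g y' F) \<in> star_entourage X F F"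
        using star_entourage_lift[OF F(2) _ c(1) c'(1)] c(2) c'(2) by simp
      then show ?thesis by (rule utilde_star_mono[OF g(1)[OF y] g(1)[OF y'] E Fe F(1)])
    qed
    then show ?thesis using lifting_image_ent[OF F(2)] by blast
  qed
  then have "ucontinuous (utilde Y) (utilde X) ?g"
    unfolding ucontinuous_utilde_iff[OF Y X] using g(1) by blast
  with bij ulift_lifts show ?thesis by (simp add: uhomeomorphism_def lifts_def)
qed

end

end

section \<open>Discrete covers lift chains\<close>

lemma orbit_of_eq_iff:
  fixes S :: "'a set"
  assumes G: "subgroup G (BijGroup S)" and x: "x \<in> S" and y: "y \<in> S"
  shows "orbit_of G x = orbit_of G y \<longleftrightarrow> (\<exists>g\<in>G. x = g y)"
proof -
  have one: "(\<lambda>x\<in>S. x) \<in> G"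
    using subgroup.one_closed[OF G] by (simp add: BijGroup_def)
  have inG: "g \<in> Bij S" if "g \<in> G" for g
    using subgroup.mem_carrier[OF G that] by (simp add: BijGroup_def)
  have comp: "compose S g h \<in> G" if "g \<in> G" "h \<in> G" for g h
    using subgroup.m_closed[OF G that] inG that by (simp add: BijGroup_def)
  have orbitI: "g z \<in> orbit_of G z" if "g \<in> G" for g and z :: 'a
    using that by (simp add: orbit_of_def)
  have inverse: "restrict (inv_into S g) S \<in> G" if "g \<in> G" for g
    using subgroup.m_inv_closed[OF G that] inG[OF that] by (simp add: inv_BijGroup)
  show ?thesis
  proof
    assume "orbit_of G x = orbit_of G y"
    moreover have "x \<in> orbit_of G x" using orbitI[OF one, of x] x by simp
    ultimately show "\<exists>g\<in>G. x = g y" by (auto simp: orbit_of_def)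
  next
    assume "\<exists>g\<in>G. x = g y"
    then obtain g where g: "g \<in> G" "x = g y" by blast
    have "inj_on g S" using inG[OF g(1)] by (simp add: Bij_def bij_betw_def)
    with g(2) x y have y': "y = restrict (inv_into S g) S x" by simp
    show "orbit_of G x = orbit_of G y"
    proof (intro equalityI subsetI)
      fix z assume "z \<in> orbit_of G x"
      then obtain h where "h \<in> G" "z = h x" by (auto simp: orbit_of_def)
      then show "z \<in> orbit_of G y"
        using orbitI[OF comp[OF _ g(1), of h], of y] y g(2) by (simp add: compose_eq)
    next
      fix z assume "z \<in> orbit_of G y"
      then obtain h where "h \<in> G" "z = h y" by (auto simp: orbit_of_def)
      then show "z \<in> orbit_of G x"
        using orbitI[OF comp[OF _ inverse[OF g(1)], of h], of x] x y' by (simp add: compose_eq)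
    qed
  qed
qed

text \<open>A step of a \<open>G\<close>-invariant entourage whose image starts at \<open>f x\<close> can be translated so as
  to start at \<open>x\<close> itself.\<close>

lemma discrete_cover_lifting_entourages:
  assumes X: "pointed_uniform_space X" and Y: "pointed_uniform_space Y"
    and cover: "discrete_cover X Y f" and E: "E \<in> entourages X"
  shows "\<exists>F. F \<subseteq> E \<and> lifting_entourage X Y f F"
proof -
  from cover obtain G h where act: "discrete_action X G"
    and h: "uhomeomorphism (quotient_space X G) Y h"
    and "\<forall>x\<in>points X. f x = h (orbit_of G x)"
    unfolding discrete_cover_def by (elim exE conjE)
  then have fh: "f x = h (orbit_of G x)" if "x \<in> points X" for x
    using that by simp
  have G: "subgroup G (BijGroup (points X))"
    and inv: "\<And>E. E \<in> entourages X \<Longrightarrow> \<exists>F\<in>entourages X. F \<subseteq> E \<and> (\<forall>g\<in>G. map_prod g g ` F = F)"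
    using act by (simp_all add: discrete_action_def)
  obtain E0 where E0: "E0 \<in> entourages X"
    "\<And>g x. g \<in> G \<Longrightarrow> x \<in> points X \<Longrightarrow> (g x, x) \<in> E0 \<Longrightarrow> g = \<one>\<^bsub>BijGroup (points X)\<^esub>"
    using act unfolding discrete_action_def by (elim exE conjE bexE) blast
  \<comment> \<open>The points of a fibre are translates of each other, so a third of \<open>E0\<close> separates them at
    three steps.\<close>
  obtain H where H: "H \<in> entourages X" "H O H O H \<subseteq> E0"
    using entourage_third[OF X E0(1)] by blast
  obtain F where F: "F \<in> entourages X" "F \<subseteq> H \<inter> E" "\<forall>g\<in>G. map_prod g g ` F = F"
    using inv[OF entourages_Int[OF H(1) E]] by blast
  have FX: "F \<subseteq> points X \<times> points X" by (rule entourage_subset[OF F(1)])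
  have hbij: "bij_betw h (orbit_of G ` points X) (points Y)"
    using h by (simp add: uhomeomorphism_def quotient_space_def)
  have gX: "g x \<in> points X" if "g \<in> G" "x \<in> points X" for g x
    using subgroup.mem_carrier[OF G that(1)] that(2)
    by (auto simp: BijGroup_def Bij_def bij_betw_def)
  have fibre: "f x = f y \<longleftrightarrow> (\<exists>g\<in>G. x = g y)" if "x \<in> points X" "y \<in> points X" for x y
    using hbij that fh orbit_of_eq_iff[OF G that]
    by (auto simp: bij_betw_def inj_on_eq_iff)
  \<comment> \<open>The quotient uniformity contains the image of \<open>F\<close>, and \<open>h\<close> carries it to \<open>Y\<close>.\<close>
  have "map_prod f f ` F \<in> entourages Y"
  proof -
    let ?q = "orbit_of G" and ?k = "inv_into (orbit_of G ` points X) h"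
    have "filterlim (map_prod ?k ?k) (filtermap (map_prod ?q ?q) (unif X)) (unif Y)"
      using h by (simp add: uhomeomorphism_def ucontinuous_def quotient_space_def)
    moreover have "eventually (\<lambda>p. p \<in> map_prod ?q ?q ` F) (filtermap (map_prod ?q ?q) (unif X))"
      using F(1) by (auto simp: eventually_filtermap entourages_def elim: eventually_mono)
    ultimately have "eventually (\<lambda>p. map_prod ?k ?k p \<in> map_prod ?q ?q ` F) (unif Y)"
      unfolding filterlim_iff by blast
    with eventually_on_points[OF Y] have "eventually (\<lambda>p. p \<in> map_prod f f ` F) (unif Y)"
    proof eventually_elim
      case (elim p)
      obtain u v where p: "p = (u, v)" by (cases p)
      with elim(2) obtain a b where ab: "(a, b) \<in> F" "?k u = ?q a" "?k v = ?q b" by auto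
      have "u = h (?k u)" "v = h (?k v)"
        using elim(1) p hbij by (auto simp: bij_betw_def intro: f_inv_into_f[symmetric])
      with ab FX fh have "u = f a" "v = f b" by auto
      with ab(1) p show ?case by force
    qed
    moreover have "f x \<in> points Y" if "x \<in> points X" for x
      using hbij fh that by (auto simp: bij_betw_def)
    then have "map_prod f f ` F \<subseteq> points Y \<times> points Y" using FX by auto
    moreover have "sym (map_prod f f ` F)"
      using entourage_sym[OF F(1)] by (force simp: sym_def)
    ultimately show ?thesis by (simp add: entourages_def)
  qed
  moreover have "\<exists>b. (x, b) \<in> F \<and> f b = y"
    if x: "x \<in> points X" and xy: "(f x, y) \<in> map_prod f f ` F" for x y
  proof -
    obtain a b where ab: "(a, b) \<in> F" "f x = f a" "y = f b" using xy by auto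
    have pts: "a \<in> points X" "b \<in> points X" using ab(1) FX by auto
    obtain g where g: "g \<in> G" "x = g a" using fibre[OF x pts(1)] ab(2) by blast
    have "(g a, g b) \<in> F" using F(3) g(1) ab(1) by force
    moreover have "f (g b) = f b" using fibre[OF gX[OF g(1) pts(2)] pts(2)] g(1) by blast
    ultimately show ?thesis using g(2) ab(3) by blast
  qed
  moreover have "a = b" if ab: "(a, b) \<in> F O F O F" "f a = f b" for a b
  proof -
    have pts: "a \<in> points X" "b \<in> points X" using ab(1) FX by auto
    obtain g where g: "g \<in> G" "a = g b" using fibre[OF pts] ab(2) by blast
    have "(a, b) \<in> E0" using ab(1) F(2) H(2) by blast
    with E0(2)[OF g(1) pts(2)] g(2) pts(2) show "a = b" by (simp add: BijGroup_def)
  qed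
  ultimately have "lifting_entourage X Y f F"
    unfolding lifting_entourage_def using F(1) by (intro conjI ballI allI impI)
  with F(2) show ?thesis by blast
qed


section \<open>Lifts of maps between coverable spaces\<close>

theorem theorem61:
  fixes X :: "'a uspace" and Y :: "'b uspace" and f :: "'a \<Rightarrow> 'b"
  assumes "pointed_uniform_space X" and "coverable X"
    and "pointed_uniform_space Y" and "coverable Y"
    and "ucontinuous X Y f" and "f (base X) = base Y"
  shows "(\<exists>!h. h \<in> lifts X Y f) \<and>
    (\<forall>x\<in>points (utilde X). \<forall>g\<in>carrier (delta1 X).
       lift X Y f (delta1_action X g x) = delta1_action Y (lift X Y f g) (lift X Y f x)) \<and>
    lift_star X Y f \<in> hom (delta1 X) (delta1 Y) \<and>
    (discrete_cover X Y f \<longrightarrow> uhomeomorphism (utilde X) (utilde Y) (lift X Y f)) \<and>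
    (\<forall>(Z :: 'c uspace) g.
       pointed_uniform_space Z \<and> ucontinuous Y Z g \<and> g (base Y) = base Z \<longrightarrow>
         (\<exists>!h. h \<in> lifts Y Z g) \<and>
         (\<exists>!h. h \<in> lifts X Z (g \<circ> f)) \<and>
         lift X Z (g \<circ> f) = compose (points (utilde X)) (lift Y Z g) (lift X Y f) \<and>
         lift_star X Z (g \<circ> f) =
           compose (carrier (delta1 X)) (lift_star Y Z g) (lift_star X Y f))"
proof -
  interpret f: based_map X Y f
    using assms by unfold_locales
  note lift_f = f.lift_eq_ulift[OF assms(2)]
  have equivariant: "lift X Y f (delta1_action X g x) =
      delta1_action Y (lift X Y f g) (lift X Y f x)"
    if "x \<in> points (utilde X)" "g \<in> carrier (delta1 X)" for x g
    using f.ulift_equivariant that by (simp add: lift_f)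
  have cover: "uhomeomorphism (utilde X) (utilde Y) (lift X Y f)" if "discrete_cover X Y f"
    using f.ulift_uhomeomorphism discrete_cover_lifting_entourages[OF f.X f.Y that]
    by (simp add: lift_f)
  have comp: "(\<exists>!h. h \<in> lifts Y Z g) \<and> (\<exists>!h. h \<in> lifts X Z (g \<circ> f)) \<and>
      lift X Z (g \<circ> f) = compose (points (utilde X)) (lift Y Z g) (lift X Y f) \<and>
      lift_star X Z (g \<circ> f) = compose (carrier (delta1 X)) (lift_star Y Z g) (lift_star X Y f)"
    if Z: "pointed_uniform_space Z" and g: "ucontinuous Y Z g" "g (base Y) = base Z"
    for Z :: "'c uspace" and g
  proof -
    interpret g: based_map Y Z g
      using assms Z g by unfold_locales
    have "filterlim (\<lambda>p. map_prod g g (map_prod f f p)) (unif Z) (unif X)"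
      using g(1) f.cont unfolding ucontinuous_def by (metis filterlim_compose)
    then have gf: "ucontinuous X Z (g \<circ> f)"
      using g.maps f.maps by (auto simp: ucontinuous_def map_prod_def case_prod_unfold)
    interpret gf: based_map X Z "g \<circ> f"
      using assms Z g gf by unfold_locales auto
    have "compose (points (utilde X)) (lift Y Z g) (lift X Y f) \<in> lifts X Z (g \<circ> f)"
      using compose_lifts[OF f.ulift_lifts g.ulift_lifts assms(1)]
      by (simp add: lift_f g.lift_eq_ulift[OF assms(4)])
    then have eq: "lift X Z (g \<circ> f) = compose (points (utilde X)) (lift Y Z g) (lift X Y f)"
      by (rule gf.lift_eqI[OF assms(2)])
    moreover have "lift_star X Z (g \<circ> f) x =
        compose (carrier (delta1 X)) (lift_star Y Z g) (lift_star X Y f) x" for x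
      using f.ulift_delta1[of x]
      by (auto simp: lift_star_def eq compose_def lift_f delta1_iff[OF f.X] restrict_def)
    ultimately show ?thesis
      using g.ex1_lifts[OF assms(4)] gf.ex1_lifts[OF assms(2)] by blast
  qed
  show ?thesis
    by (intro conjI ballI allI impI f.ex1_lifts[OF assms(2)] f.lift_star_hom[OF assms(2)];
        (elim conjE)?; simp add: equivariant cover comp del: o_apply)
qed

end
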